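(* Let $\mathcal{M}$ be a matroid of rank $r\geq 2$. Then $\nu(I_{\mathcal{M}})=1$ if and only if $\mathcal{M}$ is binary and the diameter of the basis graph $\mathcal{G}_{\mathcal{M}}$ is at most $2$.
   Context: Let $\mathcal{M}$ be a matroid on $E=\{1,\ldots,n\}$ with set of bases $\mathcal{B}$, $k$ a field, $R=k[y_B\mid B\in\mathcal{B}]$ and $\varphi:R\to k[x_1,\ldots,x_n]$ the $k$-algebra map $y_B\mapsto\prod_{i\in B}x_i$; the toric ideal is $I_{\mathcal{M}}=\ker\varphi$. $\nu(I_{\mathcal{M}})$ is the number of minimal generating sets of $I_{\mathcal{M}}$ consisting of binomials, where binomials differing only by sign are identified. A matroid is binary if it is representable over the field with two elements. The basis graph $\mathcal{G}_{\mathcal{M}}$ is the undirected graph with vertex set $\mathcal{B}$ and an edge $\{B,B'\}$ whenever $|B\setminus B'|=1$; its diameter is the maximum distance between two vertices. *)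

theory Defs
  imports "HOL-Library.Poly_Mapping" "HOL-Library.Z2"
begin

definition matroid_bases :: "nat \<Rightarrow> nat set set \<Rightarrow> bool" where
  "matroid_bases n \<B> \<longleftrightarrow>
     \<B> \<noteq> {} \<and> (\<forall>B\<in>\<B>. B \<subseteq> {1..n}) \<and>
     (\<forall>B1\<in>\<B>. \<forall>B2\<in>\<B>. \<forall>x\<in>B1 - B2. \<exists>y\<in>B2 - B1. insert y (B1 - {x}) \<in> \<B>)"

definition gf2_indep :: "(nat \<Rightarrow> nat \<Rightarrow> bit) \<Rightarrow> nat set \<Rightarrow> bool" where
  "gf2_indep v A \<longleftrightarrow>
     (\<forall>c :: nat \<Rightarrow> bit. (\<forall>j. (\<Sum>i\<in>A. c i * v i j) = 0) \<longrightarrow> (\<forall>i\<in>A. c i = 0))"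

definition binary_matroid :: "nat \<Rightarrow> nat set set \<Rightarrow> bool" where
  "binary_matroid n \<B> \<longleftrightarrow>
     (\<exists>v :: nat \<Rightarrow> nat \<Rightarrow> bit. \<forall>B. B \<in> \<B> \<longleftrightarrow>
        (B \<subseteq> {1..n} \<and> gf2_indep v B \<and>
         (\<forall>A. A \<subseteq> {1..n} \<and> gf2_indep v A \<longrightarrow> card A \<le> card B)))"

definition bg_adj :: "nat set \<Rightarrow> nat set \<Rightarrow> bool" where
  "bg_adj B B' \<longleftrightarrow> card (B - B') = 1"

definition bg_walk :: "nat set set \<Rightarrow> nat set list \<Rightarrow> bool" where
  "bg_walk \<B> xs \<longleftrightarrow> xs \<noteq> [] \<and> set xs \<subseteq> \<B> \<and>
     (\<forall>i. Suc i < length xs \<longrightarrow> bg_adj (xs ! i) (xs ! Suc i))"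

definition bg_dist :: "nat set set \<Rightarrow> nat set \<Rightarrow> nat set \<Rightarrow> nat" where
  "bg_dist \<B> B B' =
     (LEAST k. \<exists>xs. bg_walk \<B> xs \<and> hd xs = B \<and> last xs = B' \<and> length xs = Suc k)"

definition bg_diameter :: "nat set set \<Rightarrow> nat" where
  "bg_diameter \<B> = Max {bg_dist \<B> B B' | B B'. B \<in> \<B> \<and> B' \<in> \<B>}"

text \<open>Polynomials in variables y_S (S a finite set of naturals) over 'k; the ring
  R = k[y_B | B in \<B>] is the set of polynomials all of whose variables are bases.\<close>


definition in_R :: "nat set set \<Rightarrow> ((nat set \<Rightarrow>\<^sub>0 nat) \<Rightarrow>\<^sub>0 'k::field) \<Rightarrow> bool" where
  "in_R \<B> p \<longleftrightarrow> (\<forall>m\<in>Poly_Mapping.keys p. Poly_Mapping.keys m \<subseteq> \<B>)"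

text \<open>phi on monomials: y^m maps to prod_B (prod_{i in B} x_i)^(m B).\<close>
definition phi_mon :: "(nat set \<Rightarrow>\<^sub>0 nat) \<Rightarrow> (nat \<Rightarrow>\<^sub>0 nat)" where
  "phi_mon m = (\<Sum>B\<in>Poly_Mapping.keys m. \<Sum>i\<in>B. Poly_Mapping.single i (Poly_Mapping.lookup m B))"

definition phi :: "((nat set \<Rightarrow>\<^sub>0 nat) \<Rightarrow>\<^sub>0 'k::field) \<Rightarrow> ((nat \<Rightarrow>\<^sub>0 nat) \<Rightarrow>\<^sub>0 'k)" where
  "phi p = (\<Sum>m\<in>Poly_Mapping.keys p. Poly_Mapping.single (phi_mon m) (Poly_Mapping.lookup p m))"

definition toric_ideal :: "nat set set \<Rightarrow> ((nat set \<Rightarrow>\<^sub>0 nat) \<Rightarrow>\<^sub>0 'k::field) set" where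
  "toric_ideal \<B> = {p. in_R \<B> p \<and> phi p = 0}"

definition ideal_gen_R :: "nat set set \<Rightarrow> ((nat set \<Rightarrow>\<^sub>0 nat) \<Rightarrow>\<^sub>0 'k::field) set \<Rightarrow> ((nat set \<Rightarrow>\<^sub>0 nat) \<Rightarrow>\<^sub>0 'k) set" where
  "ideal_gen_R \<B> S = {(\<Sum>s\<in>F. c s * s) | F c. finite F \<and> F \<subseteq> S \<and> (\<forall>s\<in>F. in_R \<B> (c s))}"

definition binomial :: "nat set set \<Rightarrow> ((nat set \<Rightarrow>\<^sub>0 nat) \<Rightarrow>\<^sub>0 'k::field) \<Rightarrow> bool" where
  "binomial \<B> f \<longleftrightarrow> (\<exists>u v. u \<noteq> v \<and> Poly_Mapping.keys u \<subseteq> \<B> \<and> Poly_Mapping.keys v \<subseteq> \<B> \<and>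
      f = Poly_Mapping.single u 1 - Poly_Mapping.single v 1)"

definition minimal_binomial_gens :: "nat set set \<Rightarrow> ((nat set \<Rightarrow>\<^sub>0 nat) \<Rightarrow>\<^sub>0 'k::field) set \<Rightarrow> bool" where
  "minimal_binomial_gens \<B> S \<longleftrightarrow>
     S \<subseteq> toric_ideal \<B> \<and> (\<forall>f\<in>S. binomial \<B> f) \<and>
     ideal_gen_R \<B> S = toric_ideal \<B> \<and>
     (\<forall>T. T \<subset> S \<longrightarrow> ideal_gen_R \<B> T \<noteq> toric_ideal \<B>)"

text \<open>nu: number of such generating sets, binomials differing only by sign identified.
  A binomial y^u - y^v is identified with its support {u, v}, which identifies
  exactly f and -f.\<close>
definition nu :: "'k::field itself \<Rightarrow> nat set set \<Rightarrow> nat" where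
  "nu (_ :: 'k itself) \<B> =
     card {(Poly_Mapping.keys ` S) | S :: ((nat set \<Rightarrow>\<^sub>0 nat) \<Rightarrow>\<^sub>0 'k) set. minimal_binomial_gens \<B> S}"

end

theory Submission
  imports Complex_Main Defs "HOL-Library.Function_Algebras" "HOL-Library.Multiset"
begin

text \<open>
  In degree two nothing of lower degree interferes, so a minimal binomial generating set restricts to
  a spanning tree on every quadratic fibre of \<open>\<phi>\<close>, and any other spanning tree would do. Hence
  uniqueness forces quadratic fibres to have at most two elements. For a pair of bases at distance at
  least three, two different symmetric exchanges already give a fibre with three elements, and a
  \<open>U\<^sub>2\<^sub>,\<^sub>4\<close>-minor gives one as well. With both excluded, every basis is at distance at most two from
  a fixed basis \<open>B\<close>, and the matrix over GF(2) of the fundamental circuits of \<open>B\<close> represents the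
  matroid.

  Conversely, at distance at most two a symmetric exchange provides a bijection as in the definition
  of strongly base orderable matroids, so that the argument of Lason and Michalek for those shows
  that quadratic binomials generate the ideal; binarity bounds the quadratic fibres by two, which
  makes the generators unique up to sign.
\<close>

section \<open>Bases and the basis graph\<close>

text \<open>Both directions pass through \<open>thin\<close>, which bounds quadratic fibres by two
  monomials: it is equivalent to \<open>nu\<close> being 1 and, separately, to
  \<open>U24_free\<close> together with diameter at most two. The obstacle in the first equivalence
  is that generation by quadrics is a conjecture of White for general matroids, so a minimal
  generating set may have generators of unknown degree. The proof therefore alters such a set inside
  one quadratic fibre and keeps everything else. In the second equivalence a local condition
  suffices for a representation because all bases lie within two exchanges of a fixed one, where
  being a basis is the nonvanishing of a minor of size at most two over GF(2); no general
  excluded-minor argument is required. Ideal membership is controlled by the functionals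
  \<open>coeff_sum C\<close>, which sum coefficients over a set of monomials closed under the
  moves.\<close>

locale basis_system =
  fixes n :: nat and \<B> :: "nat set set"
  assumes matroid: "matroid_bases n \<B>"
begin

lemma basis_subset: "B \<in> \<B> \<Longrightarrow> B \<subseteq> {1..n}"
  and nonempty: "\<B> \<noteq> {}"
  and exchange: "B1 \<in> \<B> \<Longrightarrow> B2 \<in> \<B> \<Longrightarrow> x \<in> B1 - B2 \<Longrightarrow>
    \<exists>y\<in>B2 - B1. insert y (B1 - {x}) \<in> \<B>"
  using matroid unfolding matroid_bases_def by blast+

lemma finite_basis: "B \<in> \<B> \<Longrightarrow> finite B"
  using basis_subset finite_subset by blast

lemma finite_bases: "finite \<B>"
  using basis_subset by (meson Pow_iff finite_Pow_iff finite_atLeastAtMost finite_subset subsetI)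

lemma card_basis_le:
  assumes "B1 \<in> \<B>" "B2 \<in> \<B>"
  shows "card B2 \<le> card B1"
  using assms
proof (induction "card (B1 - B2)" arbitrary: B1 rule: less_induct)
  case less
  note fin = finite_basis[OF less.prems(1)] finite_basis[OF less.prems(2)]
  show ?case
  proof (cases "B1 \<subseteq> B2")
    case True
    then have "B2 \<subseteq> B1"
      using exchange[OF less.prems(2,1)] by blast
    then show ?thesis using fin by (simp add: card_mono)
  next
    case False
    then obtain x where x: "x \<in> B1 - B2" by blast
    obtain y where y: "y \<in> B2 - B1" "insert y (B1 - {x}) \<in> \<B>"
      using exchange[OF less.prems x] by blast
    have "insert y (B1 - {x}) - B2 = (B1 - B2) - {x}" using x y by auto
    then have "card (insert y (B1 - {x}) - B2) < card (B1 - B2)"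
      using x fin by (metis card_Diff1_less finite_Diff)
    then have "card B2 \<le> card (insert y (B1 - {x}))"
      using less.hyps[OF _ y(2) less.prems(2)] by blast
    also have "\<dots> = card B1"
      using x y(1) fin by (simp add: card.insert_remove card_Suc_Diff1 del: card_Diff_insert)
    finally show ?thesis .
  qed
qed

lemma card_basis_eq: "B1 \<in> \<B> \<Longrightarrow> B2 \<in> \<B> \<Longrightarrow> card B1 = card B2"
  using card_basis_le by (meson le_antisym)

lemma basis_eqI: "B1 \<in> \<B> \<Longrightarrow> B2 \<in> \<B> \<Longrightarrow> B1 \<subseteq> B2 \<Longrightarrow> B1 = B2"
  using card_basis_eq finite_basis card_subset_eq by metis

lemma card_Diff_basis_commute:
  assumes "B1 \<in> \<B>" "B2 \<in> \<B>"
  shows "card (B2 - B1) = card (B1 - B2)"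
  using card_basis_eq[OF assms] finite_basis[OF assms(1)] finite_basis[OF assms(2)]
  by (metis card_le_sym_Diff le_antisym order_refl)

text \<open>Independent sets are subsets of bases, so this is the augmentation property without that
  notion: exchanging an element of \<open>D\<close> outside \<open>A \<union> B\<close> against one
  of \<open>B\<close> keeps \<open>A\<close> inside and brings \<open>D\<close> closer to
  \<open>A \<union> B\<close>.\<close>

lemma extend_from_basis:
  assumes "A \<subseteq> D" "D \<in> \<B>" "B \<in> \<B>"
  shows "\<exists>D'\<in>\<B>. A \<subseteq> D' \<and> D' \<subseteq> A \<union> B"
  using assms(1,2)
proof (induction "card (D - (A \<union> B))" arbitrary: D rule: less_induct)
  case less
  show ?case
  proof (cases "D \<subseteq> A \<union> B")
    case False
    then obtain d where d: "d \<in> D" "d \<notin> A" "d \<notin> B" by blast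
    then obtain y where y: "y \<in> B - D" "insert y (D - {d}) \<in> \<B>"
      using exchange[OF less.prems(2) assms(3)] by blast
    have "insert y (D - {d}) - (A \<union> B) = (D - (A \<union> B)) - {d}" using y by auto
    then have "card (insert y (D - {d}) - (A \<union> B)) < card (D - (A \<union> B))"
      using d finite_basis[OF less.prems(2)] by (metis DiffI UnE card_Diff1_less finite_Diff)
    then show ?thesis using less.hyps[OF _ _ y(2)] less.prems(1) d by blast
  qed (use less.prems in blast)
qed

text \<open>The elements of \<open>C\<close> together with \<open>x\<close> form the fundamental circuit of \<open>x\<close> in \<open>B2\<close>; it
  cannot be contained in the closure of \<open>B1 - {x}\<close>.\<close>
lemma symmetric_exchange:
  assumes "B1 \<in> \<B>" "B2 \<in> \<B>" "x \<in> B1 - B2"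
  obtains y where "y \<in> B2 - B1" "insert y (B1 - {x}) \<in> \<B>" "insert x (B2 - {y}) \<in> \<B>"
proof -
  define C where "C = {y \<in> B2. insert x (B2 - {y}) \<in> \<B>}"
  have "C \<subseteq> B2" by (auto simp: C_def)
  from extend_from_basis[OF this assms(2,1)]
  obtain D where D: "D \<in> \<B>" "C \<subseteq> D" "D \<subseteq> C \<union> B1" by blast
  have "x \<notin> D"
  proof
    assume "x \<in> D"
    then have "insert x C \<subseteq> D" using D by blast
    \<comment> \<open>If the fundamental circuit were independent, it would extend within
      \<open>insert x B2\<close> to a basis \<open>D'\<close>. This basis omits some
      \<open>z\<close> of \<open>B2\<close>; then \<open>x\<close> can replace \<open>z\<close>, so
      \<open>z\<close> belongs to \<open>C\<close>, which \<open>D'\<close> contains.\<close>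
    from extend_from_basis[OF this D(1) assms(2)]
    obtain D' where D': "D' \<in> \<B>" "insert x C \<subseteq> D'" "D' \<subseteq> insert x B2"
      using \<open>C \<subseteq> B2\<close> by blast
    have "\<not> B2 \<subseteq> D'"
      using basis_eqI[OF assms(2) D'(1)] D' assms(3) by blast
    then obtain z where z: "z \<in> B2" "z \<notin> D'" by blast
    have "D' \<subseteq> insert x (B2 - {z})" using D' z by blast
    moreover have "card D' = card (insert x (B2 - {z}))"
      using card_basis_eq[OF D'(1) assms(2)] z assms(3) finite_basis[OF assms(2)]
      by (simp add: card_insert_if card_Suc_Diff1 del: card_Diff_insert)
    ultimately have "D' = insert x (B2 - {z})"
      using finite_basis[OF assms(2)] by (simp add: card_subset_eq)
    then have "z \<in> C" using D' z by (auto simp: C_def)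
    then show False using D' z by blast
  qed
  \<comment> \<open>As \<open>D\<close> lies in \<open>C \<union> B1\<close>, an exchange partner
    outside \<open>B1\<close> comes from \<open>C\<close> and so works on both sides.\<close>
  then obtain y where y: "y \<in> D - B1" "insert y (B1 - {x}) \<in> \<B>"
    using exchange[OF assms(1) D(1)] assms(3) by blast
  then have "y \<in> C" using D by blast
  then show ?thesis using that[of y] y by (auto simp: C_def)
qed

section \<open>Distances in the basis graph\<close>

lemma bg_walk_exists:
  assumes "B1 \<in> \<B>" "B2 \<in> \<B>"
  shows "\<exists>xs. bg_walk \<B> xs \<and> hd xs = B1 \<and> last xs = B2 \<and> length xs = Suc (card (B1 - B2))"
  using assms
proof (induction "card (B1 - B2)" arbitrary: B1)
  case 0
  then have "B1 = B2" using basis_eqI[OF 0(2,3)] finite_basis by auto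
  then show ?case using 0 by (intro exI[of _ "[B1]"]) (auto simp: bg_walk_def)
next
  case (Suc k)
  then obtain x where x: "x \<in> B1 - B2" by (metis card.empty equals0I nat.distinct(1))
  obtain y where y: "y \<in> B2 - B1" "insert y (B1 - {x}) \<in> \<B>"
    using exchange[OF Suc.prems x] by blast
  define B where "B = insert y (B1 - {x})"
  have "B - B2 = (B1 - B2) - {x}" using x y by (auto simp: B_def)
  then have "card (B - B2) = k"
    using x Suc.hyps(2) finite_basis[OF Suc.prems(1)] by simp
  then obtain xs where xs: "bg_walk \<B> xs" "hd xs = B" "last xs = B2" "length xs = Suc k"
    using Suc.hyps(1)[of B] y(2) Suc.prems(2) B_def by auto
  have "B1 - B = {x}" using x y by (auto simp: B_def)
  then have "bg_walk \<B> (B1 # xs)"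
    using xs Suc.prems(1)
    by (auto simp: bg_walk_def bg_adj_def nth_Cons hd_conv_nth split: nat.splits)
  then show ?case
    using xs Suc.hyps(2) by (intro exI[of _ "B1 # xs"]) (auto simp: bg_walk_def)
qed

lemma card_Diff_le_bg_walk:
  "bg_walk \<B> xs \<Longrightarrow> card (hd xs - last xs) < length xs"
proof (induction xs)
  case (Cons B xs)
  show ?case
  proof (cases xs)
    case (Cons B' ys)
    have "bg_walk \<B> xs"
      using \<open>bg_walk \<B> (B # xs)\<close> Cons by (auto simp: bg_walk_def)
    then have 1: "card (B' - last xs) < length xs" using Cons.IH Cons by simp
    have 2: "card (B - B') = 1" and fin: "finite B" "finite B'"
      using Cons.prems Cons finite_basis by (force simp: bg_walk_def bg_adj_def)+
    have "card (B - last xs) \<le> card ((B - B') \<union> (B' - last xs))"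
      using fin by (intro card_mono) auto
    also have "\<dots> \<le> card (B - B') + card (B' - last xs)" by (rule card_Un_le)
    finally show ?thesis using 1 2 Cons by simp
  qed simp
qed (simp add: bg_walk_def)

text \<open>An exchange towards \<open>B2\<close> lowers the difference by one, and no edge lowers
  it by more. Hence set differences replace the graph from here on.\<close>

lemma bg_dist_eq:
  assumes "B1 \<in> \<B>" "B2 \<in> \<B>"
  shows "bg_dist \<B> B1 B2 = card (B1 - B2)"
  unfolding bg_dist_def
proof (rule Least_equality)
  show "\<exists>xs. bg_walk \<B> xs \<and> hd xs = B1 \<and> last xs = B2 \<and> length xs = Suc (card (B1 - B2))"
    by (rule bg_walk_exists[OF assms])
  show "card (B1 - B2) \<le> k"
    if "\<exists>xs. bg_walk \<B> xs \<and> hd xs = B1 \<and> last xs = B2 \<and> length xs = Suc k" for k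
    using that card_Diff_le_bg_walk by fastforce
qed

lemma bg_diameter_le_iff:
  "bg_diameter \<B> \<le> d \<longleftrightarrow> (\<forall>B1\<in>\<B>. \<forall>B2\<in>\<B>. card (B1 - B2) \<le> d)"
proof -
  let ?D = "{bg_dist \<B> B B' | B B'. B \<in> \<B> \<and> B' \<in> \<B>}"
  have "?D = (\<lambda>(B, B'). bg_dist \<B> B B') ` (\<B> \<times> \<B>)" by auto
  then have "finite ?D" "?D \<noteq> {}" using finite_bases nonempty by auto
  then have "bg_diameter \<B> \<le> d \<longleftrightarrow> (\<forall>k\<in>?D. k \<le> d)"
    unfolding bg_diameter_def by (rule Max_le_iff)
  also have "\<dots> \<longleftrightarrow> (\<forall>B1\<in>\<B>. \<forall>B2\<in>\<B>. bg_dist \<B> B1 B2 \<le> d)" by blast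
  finally show ?thesis by (simp add: bg_dist_eq)
qed

end

section \<open>Binary matroids of diameter two\<close>

text \<open>A \<open>U\<^sub>2\<^sub>,\<^sub>4\<close>-minor, seen from one pair of bases at distance two.\<close>
definition U24_free :: "nat set set \<Rightarrow> bool" where
  "U24_free \<B> \<longleftrightarrow> \<not> (\<exists>B e f g h. e \<in> B \<and> f \<in> B \<and> e \<noteq> f \<and> g \<notin> B \<and> h \<notin> B \<and> g \<noteq> h \<and>
     B \<in> \<B> \<and> insert g (B - {e}) \<in> \<B> \<and> insert h (B - {e}) \<in> \<B> \<and>
     insert g (B - {f}) \<in> \<B> \<and> insert h (B - {f}) \<in> \<B> \<and>
     insert g (insert h (B - {e, f})) \<in> \<B>)"

context basis_system
begin

text \<open>This is the 2x2 determinant over GF(2), with entries telling which single exchanges are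
  possible. If \<open>?X\<close> is a basis, a symmetric exchange makes one of the two products
  nonzero, and both being nonzero is the excluded configuration.\<close>

lemma double_exchange_iff:
  assumes "U24_free \<B>" "B \<in> \<B>" "e \<in> B" "f \<in> B" "e \<noteq> f" "g \<notin> B" "h \<notin> B" "g \<noteq> h"
  shows "insert g (insert h (B - {e, f})) \<in> \<B> \<longleftrightarrow>
    (insert g (B - {e}) \<in> \<B> \<and> insert h (B - {f}) \<in> \<B>) \<noteq>
    (insert h (B - {e}) \<in> \<B> \<and> insert g (B - {f}) \<in> \<B>)"
    (is "?X \<in> \<B> \<longleftrightarrow> (?eg \<in> \<B> \<and> ?fh \<in> \<B>) \<noteq> (?eh \<in> \<B> \<and> ?fg \<in> \<B>)")
proof
  assume X: "?X \<in> \<B>"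
  have "e \<in> B - ?X" using assms by auto
  from symmetric_exchange[OF assms(2) X this] obtain y where
    y: "y \<in> ?X - B" "insert y (B - {e}) \<in> \<B>" "insert e (?X - {y}) \<in> \<B>" .
  have "insert e (?X - {g}) = ?fh" "insert e (?X - {h}) = ?fg" using assms by auto
  then have "?eg \<in> \<B> \<and> ?fh \<in> \<B> \<or> ?eh \<in> \<B> \<and> ?fg \<in> \<B>"
    using y by auto
  moreover have "\<not> (?eg \<in> \<B> \<and> ?fh \<in> \<B> \<and> ?eh \<in> \<B> \<and> ?fg \<in> \<B>)"
    using assms X unfolding U24_free_def by blast
  ultimately show "(?eg \<in> \<B> \<and> ?fh \<in> \<B>) \<noteq> (?eh \<in> \<B> \<and> ?fg \<in> \<B>)" by blast
next
  \<comment> \<open>One product is nonzero, the other zero. Each of the two exchanges between the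
    neighbours yields the double exchange or a factor of the vanishing product, and not both factors
    are available.\<close>
  have *: "insert g (insert h (B - {e, f})) \<in> \<B>"
    if "e \<in> B" "f \<in> B" "e \<noteq> f" "g \<notin> B" "h \<notin> B" "g \<noteq> h"
      "insert g (B - {e}) \<in> \<B>" "insert h (B - {f}) \<in> \<B>"
      "\<not> (insert h (B - {e}) \<in> \<B> \<and> insert g (B - {f}) \<in> \<B>)" for e f g h
  proof -
    have "\<exists>y\<in>insert h (B - {f}) - insert g (B - {e}). insert y (insert g (B - {e}) - {f}) \<in> \<B>"
      by (rule exchange) (use that in auto)
    moreover have "insert h (B - {f}) - insert g (B - {e}) = {e, h}" using that by auto
    moreover have "insert e (insert g (B - {e}) - {f}) = insert g (B - {f})"
      "insert h (insert g (B - {e}) - {f}) = insert g (insert h (B - {e, f}))"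
      using that by auto
    ultimately have 1: "insert g (B - {f}) \<in> \<B> \<or> insert g (insert h (B - {e, f})) \<in> \<B>" by auto
    have "\<exists>y\<in>insert g (B - {e}) - insert h (B - {f}). insert y (insert h (B - {f}) - {e}) \<in> \<B>"
      by (rule exchange) (use that in auto)
    moreover have "insert g (B - {e}) - insert h (B - {f}) = {f, g}" using that by auto
    moreover have "insert f (insert h (B - {f}) - {e}) = insert h (B - {e})"
      "insert g (insert h (B - {f}) - {e}) = insert g (insert h (B - {e, f}))"
      using that by auto
    ultimately show ?thesis using 1 that(9) by auto
  qed
  assume "(?eg \<in> \<B> \<and> ?fh \<in> \<B>) \<noteq> (?eh \<in> \<B> \<and> ?fg \<in> \<B>)"
  then show "?X \<in> \<B>"
    using *[of e f g h] *[of e f h g] assms by (auto simp: insert_commute)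
qed

lemma basis_at_distance_le_2:
  assumes "B \<in> \<B>" "X \<in> \<B>" "card (X - B) \<le> 2"
  obtains "X = B"
  | e g where "e \<in> B" "g \<notin> B" "X = insert g (B - {e})"
  | e f g h where "e \<in> B" "f \<in> B" "e \<noteq> f" "g \<notin> B" "h \<notin> B" "g \<noteq> h"
      "X = insert g (insert h (B - {e, f}))"
proof -
  have c: "card (B - X) = card (X - B)"
    using card_Diff_basis_commute assms by blast
  have X: "X = (X - B) \<union> (B - (B - X))" by blast
  consider "card (X - B) = 0" | "card (X - B) = 1" | "card (X - B) = 2"
    using assms(3) by linarith
  then show thesis
  proof cases
    case 1
    then have "X - B = {}" using finite_basis[OF assms(2)] by simp
    then show ?thesis using that(1) basis_eqI[OF assms(2,1)] by blast
  next
    case 2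
    obtain g where g: "X - B = {g}" using 2 card_1_singletonE by blast
    obtain e where e: "B - X = {e}" using 2 c by (metis card_1_singletonE)
    have "X = insert g (B - {e})" using g e by blast
    then show ?thesis using that(2)[of e g] g e by blast
  next
    case 3
    obtain g h where g: "X - B = {g, h}" "g \<noteq> h" using 3 by (meson card_2_iff)
    obtain e f where e: "B - X = {e, f}" "e \<noteq> f" using 3 c by (metis card_2_iff)
    have "X = insert g (insert h (B - {e, f}))" using g e by blast
    then show ?thesis using that(3)[of e f g h] g e by blast
  qed
qed

end

text \<open>A basis of \<open>\<C>\<close> at distance three from \<open>B\<close> would yield, by a symmetric exchange, two bases
  at distances one and two from \<open>B\<close> and three from each other; both would lie in \<open>\<B>\<close>.\<close>
lemma bases_eq_of_neighbours_eq:
  assumes "matroid_bases n \<B>" "matroid_bases n \<C>" "U24_free \<B>" "U24_free \<C>"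
    and diam: "\<And>B1 B2. B1 \<in> \<B> \<Longrightarrow> B2 \<in> \<B> \<Longrightarrow> card (B1 - B2) \<le> 2"
    and B: "B \<in> \<B>" "B \<in> \<C>"
    and nb: "\<And>e g. e \<in> B \<Longrightarrow> g \<notin> B \<Longrightarrow>
      insert g (B - {e}) \<in> \<B> \<longleftrightarrow> insert g (B - {e}) \<in> \<C>"
  shows "\<B> = \<C>"
proof -
  interpret b: basis_system n \<B> by unfold_locales fact
  interpret c: basis_system n \<C> by unfold_locales fact
  have double: "insert g (insert h (B - {e, f})) \<in> \<B> \<longleftrightarrow> insert g (insert h (B - {e, f})) \<in> \<C>"
    if "e \<in> B" "f \<in> B" "e \<noteq> f" "g \<notin> B" "h \<notin> B" "g \<noteq> h" for e f g h
    using b.double_exchange_iff[OF assms(3) B(1) that] c.double_exchange_iff[OF assms(4) B(2) that]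
      that nb by simp
  have near: "X \<in> \<B>" if "X \<in> \<C>" "card (X - B) \<le> 2" for X
    using c.basis_at_distance_le_2[OF B(2) that] B nb double that(1) by metis
  \<comment> \<open>The diameter bound is assumed for \<open>\<B>\<close>; this carries it over to
    \<open>\<C>\<close>. By induction \<open>?Y\<close> is within distance two of \<open>B\<close>,
    so a counterexample \<open>X\<close> is at distance exactly three.\<close>
  have far: "card (X - B) \<le> 2" if "X \<in> \<C>" for X
    using that
  proof (induction "card (X - B)" arbitrary: X rule: less_induct)
    case less
    show ?case
    proof (rule ccontr)
      assume big: "\<not> card (X - B) \<le> 2"
      note finX = c.finite_basis[OF less.prems]
      from big have "card (X - B) \<noteq> 0" by linarith
      then have "X - B \<noteq> {}" by (metis card.empty)
      then obtain x where x: "x \<in> X - B" by blast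
      obtain y where y: "y \<in> B - X" "insert y (X - {x}) \<in> \<C>" "insert x (B - {y}) \<in> \<C>"
        using c.symmetric_exchange[OF less.prems B(2) x] .
      let ?Y = "insert y (X - {x})" and ?Z = "insert x (B - {y})"
      have "?Y - B = (X - B) - {x}" using y by auto
      then have cY: "card (?Y - B) = card (X - B) - 1" using x finX by simp
      then have Y2: "card (?Y - B) \<le> 2" using less.hyps[OF _ y(2)] big by linarith
      then have "?Y \<in> \<B>" using near y by blast
      moreover have "?Z \<in> \<B>" using nb[of y x] x y by blast
      ultimately have "card (?Z - ?Y) \<le> 2" using diam by blast
      moreover have "?Z - ?Y = insert x ((B - X) - {y})" using x y by auto
      moreover have "card (B - X) = card (X - B)"
        using c.card_Diff_basis_commute less.prems B(2) by blast
      ultimately show False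
        using big x y c.finite_basis[OF B(2)] by (simp add: card.insert_remove)
    qed
  qed
  have "X \<in> \<C>" if "X \<in> \<B>" for X
    using b.basis_at_distance_le_2[OF B(1) that diam[OF that B(1)]] B nb double that by metis
  then show ?thesis using near far by blast
qed

text \<open>The default simplification rules for \<^typ>\<open>bit\<close> replace the field operations by Boolean ones.\<close>
declare add_bit_eq_xor [simp del] mult_bit_eq_and [simp del] minus_bit_def [simp del]
  uminus_bit_def [simp del]

lemma bit_add_eq_0_iff: "(a::bit) + b = 0 \<longleftrightarrow> a = b"
  by (cases a; cases b) auto

text \<open>Modulo the span of \<open>B - {e, f}\<close> there are only three nonzero vectors.\<close>
lemma binary_imp_U24_free:
  assumes "binary_matroid n \<B>"
  shows "U24_free \<B>"
  unfolding U24_free_def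
proof safe
  fix B e f g h
  assume ef: "e \<in> B" "f \<in> B" "e \<noteq> f" and gh: "g \<notin> B" "h \<notin> B" "g \<noteq> h"
    and b: "B \<in> \<B>" "insert g (B - {e}) \<in> \<B>" "insert h (B - {e}) \<in> \<B>"
      "insert g (B - {f}) \<in> \<B>" "insert h (B - {f}) \<in> \<B>"
      "insert g (insert h (B - {e, f})) \<in> \<B>"
  obtain v where v: "\<And>B. B \<in> \<B> \<longleftrightarrow> B \<subseteq> {1..n} \<and> gf2_indep v B \<and>
      (\<forall>A. A \<subseteq> {1..n} \<and> gf2_indep v A \<longrightarrow> card A \<le> card B)"
    using assms unfolding binary_matroid_def by blast
  have sub: "B \<subseteq> {1..n}" and ind: "gf2_indep v B"
    and max: "A \<subseteq> {1..n} \<Longrightarrow> gf2_indep v A \<Longrightarrow> card A \<le> card B"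
    if "B \<in> \<B>" for B A
    using v[of B] that by auto
  have fin: "finite B" using sub[OF b(1)] finite_subset by blast
  define Z where "Z = B - {e, f}"
  have finZ: "finite Z" and Z: "e \<notin> Z" "f \<notin> Z" "g \<notin> Z" "h \<notin> Z" and B: "B = insert e (insert f Z)"
    using fin ef gh by (auto simp: Z_def)
  \<comment> \<open>The set \<open>insert x B\<close> is too large to be independent. In its
    relation \<open>e\<close>, \<open>f\<close> and \<open>x\<close> all have coefficient 1:
    dropping any one of them leaves a basis, which admits no relation.\<close>
  have dep: "\<exists>c. \<forall>j. v e j + v f j + v x j + (\<Sum>i\<in>Z. c i * v i j) = 0"
    if x: "x \<notin> B" "insert x (B - {e}) \<in> \<B>" "insert x (B - {f}) \<in> \<B>" for x
  proof -
    have "insert x B \<subseteq> {1..n}" using sub[OF b(1)] sub[OF x(2)] by blast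
    moreover have "card (insert x B) > card B" using x fin by simp
    ultimately have "\<not> gf2_indep v (insert x B)" using max[OF b(1)] leD by blast
    then obtain c i where c: "\<And>j. (\<Sum>i\<in>insert x B. c i * v i j) = 0" "i \<in> insert x B" "c i \<noteq> 0"
      unfolding gf2_indep_def by blast
    have xB: "x \<noteq> e" "x \<noteq> f" "x \<notin> Z" using x ef by (auto simp: Z_def)
    have eq: "c e * v e j + (c f * v f j + (c x * v x j + (\<Sum>i\<in>Z. c i * v i j))) = 0" for j
      using c(1)[of j] finZ Z xB ef(3) unfolding B by (simp add: algebra_simps)
    have "c y \<noteq> 0" if "y \<in> {e, f, x}" for y
    proof
      assume "c y = 0"
      define A where "A = insert x B - {y}"
      have "A \<in> \<B>"
        using that b(1) x xB ef by (auto simp: A_def insert_Diff_if)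
      note ind[OF this]
      moreover have "(\<Sum>i\<in>A. c i * v i j) = 0" for j
        using c(1)[of j] \<open>c y = 0\<close> fin that unfolding A_def
        by (subst (asm) sum.remove[of _ y]) (auto simp: B)
      ultimately have "\<forall>i\<in>A. c i = 0" unfolding gf2_indep_def by blast
      then show False using c(2,3) \<open>c y = 0\<close> unfolding A_def by blast
    qed
    then have "c e = 1" "c f = 1" "c x = 1" by (auto simp: bit_not_zero_iff)
    then show ?thesis using eq by (intro exI[of _ c]) (simp add: algebra_simps)
  qed
  obtain c d where c: "\<And>j. v e j + v f j + v g j + (\<Sum>i\<in>Z. c i * v i j) = 0"
    and d: "\<And>j. v e j + v f j + v h j + (\<Sum>i\<in>Z. d i * v i j) = 0"
    using dep[of g] dep[of h] gh b by blast
  \<comment> \<open>Adding the relations for \<open>g\<close> and \<open>h\<close> cancels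
    \<open>e\<close> and \<open>f\<close> and leaves one supported on \<open>g\<close>,
    \<open>h\<close> and \<open>Z\<close>, that is, on the sixth basis.\<close>
  define k where "k i = (if i \<in> Z then c i + d i else 1)" for i
  have "(\<Sum>i\<in>insert g (insert h Z). k i * v i j) = 0" for j
  proof -
    have "(\<Sum>i\<in>Z. k i * v i j) = (\<Sum>i\<in>Z. c i * v i j) + (\<Sum>i\<in>Z. d i * v i j)"
      by (simp add: k_def distrib_right sum.distrib)
    moreover have "v g j + (\<Sum>i\<in>Z. c i * v i j) = v h j + (\<Sum>i\<in>Z. d i * v i j)"
      using c[of j] d[of j] by (simp add: bit_add_eq_0_iff add.assoc)
    moreover have "(\<Sum>i\<in>insert g (insert h Z). k i * v i j) =
        v g j + (v h j + (\<Sum>i\<in>Z. k i * v i j))"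
      using finZ Z gh by (simp add: k_def)
    moreover have "a + p = b + q \<Longrightarrow> a + (b + (p + q)) = 0" for a b p q :: bit
      by (cases a; cases b; cases p; cases q) auto
    ultimately show ?thesis by simp
  qed
  moreover have "gf2_indep v (insert g (insert h Z))" using ind[OF b(6)] by (simp add: Z_def)
  ultimately have "k g = 0" unfolding gf2_indep_def by blast
  then show False using Z by (simp add: k_def)
qed

section \<open>Linear algebra over GF(2)\<close>

interpretation gf2: vector_space "\<lambda>(c::bit) (f::nat \<Rightarrow> bit) j. c * f j"
  by unfold_locales (auto simp: fun_eq_iff distrib_left distrib_right)

lemma sum_fun_apply: "(\<Sum>i\<in>A. f i) x = (\<Sum>i\<in>A. f i x)"
  by (induction A rule: infinite_finite_induct) auto

text \<open>\<open>gf2_indep\<close> speaks of families indexed by \<open>A\<close>, the library of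
  sets of vectors. Injectivity makes up the difference: parallel elements carry equal vectors, which
  collapse in the image. The translation gives access to the Steinitz bound.\<close>

lemma gf2_indep_iff:
  assumes "finite A"
  shows "gf2_indep v A \<longleftrightarrow> inj_on v A \<and> gf2.independent (v ` A)"
proof
  assume ind: "gf2_indep v A"
  have inj: "inj_on v A"
  proof (rule inj_onI, rule ccontr)
    fix x y assume xy: "x \<in> A" "y \<in> A" "v x = v y" "x \<noteq> y"
    define c :: "nat \<Rightarrow> bit" where "c i = of_bool (i = x \<or> i = y)" for i
    have "(\<Sum>i\<in>A. c i * v i j) = 0" for j
    proof -
      have "(\<Sum>i\<in>A. c i * v i j) = (\<Sum>i\<in>{x, y}. v i j)"
        using assms xy by (intro sum.mono_neutral_cong_right) (auto simp: c_def)
      then show ?thesis using xy by (simp add: bit_add_eq_0_iff)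
    qed
    then have "\<forall>i\<in>A. c i = 0" using ind unfolding gf2_indep_def by blast
    then have "c x = 0" using xy(1) by blast
    then show False by (simp add: c_def)
  qed
  moreover have "gf2.independent (v ` A)"
  proof
    assume "gf2.dependent (v ` A)"
    then obtain u w where u: "w \<in> v ` A" "u w \<noteq> 0" "(\<Sum>w\<in>v ` A. (\<lambda>j. u w * w j)) = 0"
      using gf2.dependent_finite[of "v ` A"] assms by auto
    have "(\<Sum>i\<in>A. u (v i) * v i j) = 0" for j
    proof -
      have "(\<Sum>i\<in>A. (\<lambda>j. u (v i) * v i j)) = 0" using u(3) inj by (simp add: sum.reindex)
      from fun_cong[OF this, of j] show ?thesis
        by (simp add: sum_fun_apply) 
    qed
    then show False using ind u(1,2) unfolding gf2_indep_def by (metis imageE)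
  qed
  ultimately show "inj_on v A \<and> gf2.independent (v ` A)" ..
next
  assume R: "inj_on v A \<and> gf2.independent (v ` A)"
  show "gf2_indep v A"
    unfolding gf2_indep_def
  proof (rule ccontr, clarsimp)
    fix c i assume c: "\<forall>j. (\<Sum>i\<in>A. c i * v i j) = 0" "i \<in> A" "c i = 1"
    define u where "u w = c (the_inv_into A v w)" for w
    have u: "u (v i) = c i" if "i \<in> A" for i using that R by (simp add: u_def the_inv_into_f_f)
    have "(\<Sum>w\<in>v ` A. (\<lambda>j. u w * w j)) = 0"
    proof
      fix j
      have "(\<Sum>w\<in>v ` A. (\<lambda>j. u w * w j)) j = (\<Sum>i\<in>A. u (v i) * v i j)"
        using R by (simp add: sum.reindex sum_fun_apply)
      also have "\<dots> = 0" using c(1) u by simp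
      finally show "(\<Sum>w\<in>v ` A. (\<lambda>j. u w * w j)) j = 0 j" by simp
    qed
    moreover have "u (v i) \<noteq> 0" using u c by simp
    ultimately have "gf2.dependent (v ` A)"
      using c(2) assms gf2.dependent_finite[of "v ` A"] by blast
    then show False using R by blast
  qed
qed

lemma gf2_card_le:
  assumes "finite A" "finite B" "gf2_indep v A" "v ` A \<subseteq> gf2.span (v ` B)"
  shows "card A \<le> card B"
proof -
  have "card A = card (v ` A)"
    using assms(1,3) by (simp add: gf2_indep_iff card_image)
  also have "\<dots> \<le> card (v ` B)"
    using gf2.independent_span_bound[of "v ` B" "v ` A"] assms by (simp add: gf2_indep_iff)
  also have "\<dots> \<le> card B" by (rule card_image_le) fact
  finally show ?thesis .
qed

lemma gf2_indep_subset:
  assumes "gf2_indep v A" "finite A" "B \<subseteq> A" shows "gf2_indep v B"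
proof -
  have "finite B" using assms finite_subset by blast
  then show ?thesis using assms gf2.independent_mono[of "v ` A" "v ` B"]
    by (auto simp: gf2_indep_iff intro: inj_on_subset)
qed

lemma gf2_indep_insertI:
  assumes "finite A" "gf2_indep v A" "v y \<notin> gf2.span (v ` A)"
  shows "gf2_indep v (insert y A)"
proof -
  have "v y \<notin> v ` A" using assms(3) gf2.span_base by blast
  then show ?thesis using assms by (auto simp: gf2_indep_iff gf2.independent_insert)
qed

text \<open>Exchange holds because \<open>B1 - {x}\<close> is too small to span \<open>B2\<close>.
  This is what makes the matrix candidate in \<open>binaryI\<close> a matroid.\<close>

lemma binary_imp_matroid:
  assumes "binary_matroid n \<B>"
  shows "matroid_bases n \<B>"
proof -
  obtain v where v: "\<And>B. B \<in> \<B> \<longleftrightarrow> B \<subseteq> {1..n} \<and> gf2_indep v B \<and>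
      (\<forall>A. A \<subseteq> {1..n} \<and> gf2_indep v A \<longrightarrow> card A \<le> card B)"
    using assms unfolding binary_matroid_def by blast
  have sub: "B \<subseteq> {1..n}" and ind: "gf2_indep v B"
    and max: "A \<subseteq> {1..n} \<Longrightarrow> gf2_indep v A \<Longrightarrow> card A \<le> card B"
    if "B \<in> \<B>" for B A
    using v[of B] that by auto
  have "\<exists>B. (B \<subseteq> {1..n} \<and> gf2_indep v B) \<and>
      (\<forall>A. A \<subseteq> {1..n} \<and> gf2_indep v A \<longrightarrow> card A \<le> card B)"
  proof (rule ex_has_greatest_nat[where b = "Suc n"])
    show "{} \<subseteq> {1..n} \<and> gf2_indep v {}" by (simp add: gf2_indep_def)
    show "\<forall>A. A \<subseteq> {1..n} \<and> gf2_indep v A \<longrightarrow> card A < Suc n"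
      using card_mono[of "{1..n}"] by (simp add: less_Suc_eq_le)
  qed
  then have "\<B> \<noteq> {}" using v by blast
  moreover have "\<exists>y\<in>B2 - B1. insert y (B1 - {x}) \<in> \<B>"
    if B: "B1 \<in> \<B>" "B2 \<in> \<B>" "x \<in> B1 - B2" for B1 B2 x
  proof -
    have fin: "finite B1" "finite B2" using sub[OF B(1)] sub[OF B(2)] finite_subset by blast+
    have card: "card B1 = card B2"
      using max[OF B(1) sub[OF B(2)] ind[OF B(2)]] max[OF B(2) sub[OF B(1)] ind[OF B(1)]] by simp
    have cx: "card (B1 - {x}) < card B1" using B(3) fin by (meson DiffD1 card_Diff1_less)
    then have "\<not> v ` B2 \<subseteq> gf2.span (v ` (B1 - {x}))"
      using gf2_card_le[of B2 "B1 - {x}" v] ind[OF B(2)] fin card by auto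
    then obtain y where y: "y \<in> B2" "v y \<notin> gf2.span (v ` (B1 - {x}))" by blast
    have y': "y \<notin> B1 - {x}"
      using y(2) gf2.span_base[of "v y" "v ` (B1 - {x})"] by blast
    let ?C = "insert y (B1 - {x})"
    have "gf2_indep v ?C"
      using y(2) ind[OF B(1)] fin by (intro gf2_indep_insertI) (auto intro: gf2_indep_subset)
    moreover have "?C \<subseteq> {1..n}" using sub[OF B(1)] sub[OF B(2)] y(1) by blast
    moreover have "card ?C = card B1"
      using y' cx B(3) fin by (simp add: card_Suc_Diff1)
    ultimately have "?C \<in> \<B>" using v[of ?C] max[OF B(1)] by simp
    then show ?thesis using y y' B(3) by (intro bexI[of _ y]) auto
  qed
  ultimately show ?thesis unfolding matroid_bases_def using sub by blast
qed

context basis_system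
begin

text \<open>The family \<open>\<C>\<close> read off from the matrix is a matroid and
  \<open>U24_free\<close> because it is binary, and the matrix is chosen so that \<open>B\<close>
  has the same neighbours in \<open>\<C>\<close> as in \<open>\<B>\<close>;
  \<open>bases_eq_of_neighbours_eq\<close> then identifies the two.\<close>

lemma binaryI:
  assumes "U24_free \<B>" and diam: "\<And>B1 B2. B1 \<in> \<B> \<Longrightarrow> B2 \<in> \<B> \<Longrightarrow> card (B1 - B2) \<le> 2"
  shows "binary_matroid n \<B>"
proof -
  obtain B where B: "B \<in> \<B>" using nonempty by blast
  note fin = finite_basis[OF B]
  \<comment> \<open>Entry \<open>j\<close> is the coordinate of \<open>i\<close> at the basis
    element \<open>j\<close>: it is 1 when \<open>i\<close> can replace \<open>j\<close>. Elements
    of \<open>B\<close> become unit vectors, since \<open>B - {j}\<close> is not a basis.\<close>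
  define v :: "nat \<Rightarrow> nat \<Rightarrow> bit" where "v i j = of_bool (j \<in> B \<and> insert i (B - {j}) \<in> \<B>)" for i j
  define \<C> where "\<C> = {X. X \<subseteq> {1..n} \<and> gf2_indep v X \<and>
    (\<forall>A. A \<subseteq> {1..n} \<and> gf2_indep v A \<longrightarrow> card A \<le> card X)}"
  have vB: "v i j = of_bool (i = j)" if "i \<in> B" for i j
  proof -
    have "B - {j} \<notin> \<B>" if "j \<in> B" using that basis_eqI[of "B - {j}" B] B by blast
    then show ?thesis using that B by (auto simp: v_def insert_absorb insert_Diff)
  qed
  have out: "v i j = 0" if "j \<notin> B" for i j using that by (simp add: v_def)
  have coord: "(\<Sum>i\<in>S. c i * v i j) = of_bool (j \<in> S) * c j" if "S \<subseteq> B" for S c j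
  proof -
    have "(\<Sum>i\<in>S. c i * v i j) = (\<Sum>i\<in>S. if i = j then c j else 0)"
      using that by (intro sum.cong) (auto simp: vB)
    moreover have "finite S" using that fin finite_subset by blast
    ultimately show ?thesis by simp
  qed
  have indB: "gf2_indep v B"
    unfolding gf2_indep_def using coord[of B] by simp
  have le: "card A \<le> card B" if "A \<subseteq> {1..n}" "gf2_indep v A" for A
  proof (rule gf2_card_le)
    show "v ` A \<subseteq> gf2.span (v ` B)"
    proof
      fix w assume "w \<in> v ` A"
      then obtain i where "w = v i" by blast
      then have "w = (\<Sum>k\<in>B. (\<lambda>j. v i k * v k j))"
        using coord[of B "v i"] out by (auto simp: fun_eq_iff sum_fun_apply)
      also have "\<dots> \<in> gf2.span (v ` B)"
        by (intro gf2.span_sum gf2.span_scale gf2.span_base) auto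
      finally show "w \<in> gf2.span (v ` B)" .
    qed
  qed (use that fin finite_subset in auto)
  then have C: "X \<in> \<C> \<longleftrightarrow> X \<subseteq> {1..n} \<and> gf2_indep v X \<and> card X = card B" for X
    using indB basis_subset[OF B] by (auto simp: \<C>_def intro: le_antisym)
  have bin: "binary_matroid n \<C>"
    unfolding binary_matroid_def \<C>_def by (intro exI[of _ v]) simp
  have "\<B> = \<C>"
  proof (rule bases_eq_of_neighbours_eq[where B = B])
    show "insert g (B - {e}) \<in> \<B> \<longleftrightarrow> insert g (B - {e}) \<in> \<C>" if "e \<in> B" "g \<notin> B" for e g
    proof
      assume "insert g (B - {e}) \<in> \<B>"
      then have vge: "v g e = 1" using that by (simp add: v_def)
      have "gf2_indep v (insert g (B - {e}))"
        unfolding gf2_indep_def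
      proof (intro allI impI)
        fix c assume c: "\<forall>j. (\<Sum>i\<in>insert g (B - {e}). c i * v i j) = 0"
        have eq: "c g * v g j + of_bool (j \<in> B - {e}) * c j = 0" for j
          using spec[OF c, of j] that fin coord[of "B - {e}" c j] by simp
        have "c g = 0" using eq[of e] vge by simp
        then show "\<forall>i\<in>insert g (B - {e}). c i = 0" using eq by fastforce
      qed
      then show "insert g (B - {e}) \<in> \<C>"
        using that fin C basis_subset[OF \<open>insert g (B - {e}) \<in> \<B>\<close>]
        by (simp add: card_insert_if card_Suc_Diff1 del: card_Diff_insert)
    next
      assume "insert g (B - {e}) \<in> \<C>"
      then have ind: "gf2_indep v (insert g (B - {e}))" using C by blast
      show "insert g (B - {e}) \<in> \<B>"
      proof (rule ccontr)
        assume "insert g (B - {e}) \<notin> \<B>"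
        then have vge: "v g e = 0" by (simp add: v_def)
        \<comment> \<open>A vanishing coordinate at \<open>e\<close> puts \<open>v g\<close> into
          the span of \<open>B - {e}\<close>; its coordinates, with 1 at \<open>g\<close>, form a
          relation in characteristic two.\<close>
        define c where "c i = (if i = g then 1 else v g i)" for i
        have "(\<Sum>i\<in>insert g (B - {e}). c i * v i j) = 0" for j
          using that fin coord[of "B - {e}" c j] vge out[of j g] by (auto simp: c_def)
        then have "c g = 0" using ind unfolding gf2_indep_def by blast
        then show False by (simp add: c_def)
      qed
    qed
  qed (use matroid binary_imp_matroid[OF bin] binary_imp_U24_free[OF bin] assms B C indB
        basis_subset in auto)
  then show ?thesis using bin by simp
qed

end

section \<open>Binomial ideals\<close>

abbreviation bnm :: "'a \<Rightarrow> 'a \<Rightarrow> 'a \<Rightarrow>\<^sub>0 'k::field" where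
  "bnm u v \<equiv> Poly_Mapping.single u 1 - Poly_Mapping.single v 1"

definition coeff_sum :: "'a set \<Rightarrow> ('a \<Rightarrow>\<^sub>0 'k::field) \<Rightarrow> 'k" where
  "coeff_sum C p = (\<Sum>m\<in>Poly_Mapping.keys p. if m \<in> C then Poly_Mapping.lookup p m else 0)"

lemma coeff_sum_superset:
  "finite A \<Longrightarrow> Poly_Mapping.keys p \<subseteq> A \<Longrightarrow>
    coeff_sum C p = (\<Sum>m\<in>A. if m \<in> C then Poly_Mapping.lookup p m else 0)"
  unfolding coeff_sum_def by (rule sum.mono_neutral_left) (auto simp: in_keys_iff)

lemma coeff_sum_zero [simp]: "coeff_sum C 0 = 0"
  by (simp add: coeff_sum_def)

lemma coeff_sum_add: "coeff_sum C (p + q) = coeff_sum C p + coeff_sum C q"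
proof -
  let ?A = "Poly_Mapping.keys p \<union> Poly_Mapping.keys q"
  have "coeff_sum C (p + q) = (\<Sum>m\<in>?A. if m \<in> C then Poly_Mapping.lookup (p + q) m else 0)"
    by (rule coeff_sum_superset) (use keys_add[of p q] in auto)
  also have "\<dots> = (\<Sum>m\<in>?A. if m \<in> C then Poly_Mapping.lookup p m else 0) +
      (\<Sum>m\<in>?A. if m \<in> C then Poly_Mapping.lookup q m else 0)"
    unfolding sum.distrib[symmetric] by (intro sum.cong) (auto simp: lookup_add)
  finally show ?thesis by (simp add: coeff_sum_superset[of ?A])
qed

lemma coeff_sum_uminus: "coeff_sum C (- p) = - coeff_sum C p"
  using coeff_sum_add[of C p "- p"] by (simp add: add_eq_0_iff)

lemma coeff_sum_diff: "coeff_sum C (p - q) = coeff_sum C p - coeff_sum C q"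
  using coeff_sum_add[of C p "- q"] by (simp add: coeff_sum_uminus)

lemma coeff_sum_sum: "coeff_sum C (\<Sum>i\<in>I. f i) = (\<Sum>i\<in>I. coeff_sum C (f i))"
  by (induction I rule: infinite_finite_induct) (simp_all add: coeff_sum_add)

lemma coeff_sum_single: "coeff_sum C (Poly_Mapping.single m a) = (if m \<in> C then a else 0)"
  by (cases "a = 0") (simp_all add: coeff_sum_def)

lemma sum_monomials: "p = (\<Sum>m\<in>Poly_Mapping.keys p. Poly_Mapping.single m (Poly_Mapping.lookup p m))"
  by (rule poly_mapping_eqI)
    (simp add: lookup_sum lookup_single when_def in_keys_iff)

lemma coeff_sum_mult_bnm:
  fixes c :: "('a::monoid_add \<Rightarrow>\<^sub>0 'k::field)"
  assumes "\<And>m. m + a \<in> C \<longleftrightarrow> m + b \<in> C"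
  shows "coeff_sum C (c * bnm a b) = 0"
proof -
  have "coeff_sum C (Poly_Mapping.single m x * bnm a b) = 0" for m and x :: 'k
    using assms by (simp add: right_diff_distrib mult_single coeff_sum_diff coeff_sum_single)
  then show ?thesis
    by (subst sum_monomials) (simp add: sum_distrib_right coeff_sum_sum)
qed

lemma lookup_phi: "Poly_Mapping.lookup (phi p) t = coeff_sum {m. phi_mon m = t} p"
  by (simp add: phi_def coeff_sum_def lookup_sum lookup_single when_def)

text \<open>The index set may be any superset \<open>A\<close>, so that two monomials can be added
  over a common one. The guard \<open>finite B\<close> stems from the convention that a sum over an
  infinite set is 0.\<close>

lemma lookup_phi_mon:
  assumes "finite A" "Poly_Mapping.keys m \<subseteq> A"
  shows "Poly_Mapping.lookup (phi_mon m) i =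
    (\<Sum>B\<in>A. if finite B \<and> i \<in> B then Poly_Mapping.lookup m B else 0)"
proof -
  have "(\<Sum>j\<in>B. Poly_Mapping.lookup (Poly_Mapping.single j x) i) =
      (if finite B \<and> i \<in> B then x else 0)" for B and x :: nat
    by (cases "finite B") (simp_all add: lookup_single when_def)
  then have "Poly_Mapping.lookup (phi_mon m) i =
      (\<Sum>B\<in>Poly_Mapping.keys m. if finite B \<and> i \<in> B then Poly_Mapping.lookup m B else 0)"
    by (simp add: phi_mon_def lookup_sum)
  also have "\<dots> = (\<Sum>B\<in>A. if finite B \<and> i \<in> B then Poly_Mapping.lookup m B else 0)"
    using assms by (intro sum.mono_neutral_left) (auto simp: in_keys_iff)
  finally show ?thesis .
qed

lemma phi_mon_add: "phi_mon (m + m') = phi_mon m + phi_mon m'"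
proof (rule poly_mapping_eqI)
  fix i
  let ?A = "Poly_Mapping.keys m \<union> Poly_Mapping.keys m'"
  have "Poly_Mapping.lookup (phi_mon (m + m')) i =
      (\<Sum>B\<in>?A. if finite B \<and> i \<in> B then Poly_Mapping.lookup (m + m') B else 0)"
    by (rule lookup_phi_mon) (use keys_add[of m m'] in auto)
  also have "\<dots> = Poly_Mapping.lookup (phi_mon m) i + Poly_Mapping.lookup (phi_mon m') i"
    by (simp add: lookup_phi_mon[of ?A] sum.distrib[symmetric] lookup_add if_distrib cong: if_cong)
  finally show "Poly_Mapping.lookup (phi_mon (m + m')) i =
      Poly_Mapping.lookup (phi_mon m + phi_mon m') i"
    by (simp add: lookup_add)
qed

lemma phi_mon_zero [simp]: "phi_mon 0 = 0"
  by (simp add: phi_mon_def)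

lemma phi_mon_single:
  "finite B \<Longrightarrow> Poly_Mapping.lookup (phi_mon (Poly_Mapping.single B 1)) i = of_bool (i \<in> B)"
  by (subst lookup_phi_mon[of "{B}"]) auto

section \<open>The ring \<open>R\<close> and its ideals\<close>

lemma in_R_zero [simp]: "in_R \<B> 0"
  by (simp add: in_R_def)

lemma in_R_single: "Poly_Mapping.keys m \<subseteq> \<B> \<Longrightarrow> in_R \<B> (Poly_Mapping.single m a)"
  by (simp add: in_R_def)

lemma in_R_one: "in_R \<B> 1"
  by (simp add: in_R_def)

lemma in_R_add: "in_R \<B> p \<Longrightarrow> in_R \<B> q \<Longrightarrow> in_R \<B> (p + q)"
  using keys_add[of p q] by (auto simp: in_R_def)

lemma in_R_uminus: "in_R \<B> p \<Longrightarrow> in_R \<B> (- p)"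
  by (simp add: in_R_def in_keys_iff)

lemma in_R_diff: "in_R \<B> p \<Longrightarrow> in_R \<B> q \<Longrightarrow> in_R \<B> (p - q)"
  using in_R_add[of \<B> p "- q"] in_R_uminus by auto

lemma in_R_mult:
  assumes "in_R \<B> p" "in_R \<B> q" shows "in_R \<B> (p * q)"
  unfolding in_R_def
proof
  fix m assume "m \<in> Poly_Mapping.keys (p * q)"
  then obtain a b where "a \<in> Poly_Mapping.keys p" "b \<in> Poly_Mapping.keys q" "m = a + b"
    using keys_mult[of p q] by blast
  then show "Poly_Mapping.keys m \<subseteq> \<B>"
    using assms keys_add[of a b] by (fastforce simp: in_R_def)
qed

lemma in_R_sum: "(\<And>i. i \<in> I \<Longrightarrow> in_R \<B> (f i)) \<Longrightarrow> in_R \<B> (\<Sum>i\<in>I. f i)"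
  by (induction I rule: infinite_finite_induct) (auto intro: in_R_add)

lemma ideal_gen_R_base: "s \<in> S \<Longrightarrow> s \<in> ideal_gen_R \<B> S"
  unfolding ideal_gen_R_def
  by (intro CollectI exI[of _ "{s}"] exI[of _ "\<lambda>_. 1"]) (auto simp: in_R_one)

lemma ideal_gen_R_zero: "0 \<in> ideal_gen_R \<B> S"
  unfolding ideal_gen_R_def by (intro CollectI exI[of _ "{}"]) auto

lemma ideal_gen_R_add:
  assumes "p \<in> ideal_gen_R \<B> S" "q \<in> ideal_gen_R \<B> S"
  shows "p + q \<in> ideal_gen_R \<B> S"
proof -
  obtain F c where p: "p = (\<Sum>s\<in>F. c s * s)" "finite F" "F \<subseteq> S" "\<forall>s\<in>F. in_R \<B> (c s)"
    using assms(1) unfolding ideal_gen_R_def by blast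
  obtain G d where q: "q = (\<Sum>s\<in>G. d s * s)" "finite G" "G \<subseteq> S" "\<forall>s\<in>G. in_R \<B> (d s)"
    using assms(2) unfolding ideal_gen_R_def by blast
  let ?e = "\<lambda>s. (if s \<in> F then c s else 0) + (if s \<in> G then d s else 0)"
  have "p = (\<Sum>s\<in>F \<union> G. (if s \<in> F then c s else 0) * s)"
    unfolding p(1) using p(2) q(2) by (intro sum.mono_neutral_cong_left) auto
  moreover have "q = (\<Sum>s\<in>F \<union> G. (if s \<in> G then d s else 0) * s)"
    unfolding q(1) using p(2) q(2) by (intro sum.mono_neutral_cong_left) auto
  ultimately have "p + q = (\<Sum>s\<in>F \<union> G. ?e s * s)"
    by (simp add: sum.distrib distrib_right)
  moreover have "\<forall>s\<in>F \<union> G. in_R \<B> (?e s)"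
    using p(4) q(4) by (auto intro: in_R_add)
  ultimately show ?thesis
    unfolding ideal_gen_R_def using p(2,3) q(2,3)
    by (intro CollectI exI[of _ "F \<union> G"] exI[of _ ?e]) simp
qed

lemma ideal_gen_R_mult:
  assumes "in_R \<B> c" "p \<in> ideal_gen_R \<B> S"
  shows "c * p \<in> ideal_gen_R \<B> S"
proof -
  obtain F d where p: "p = (\<Sum>s\<in>F. d s * s)" "finite F" "F \<subseteq> S" "\<forall>s\<in>F. in_R \<B> (d s)"
    using assms(2) unfolding ideal_gen_R_def by blast
  have "c * p = (\<Sum>s\<in>F. (c * d s) * s)"
    by (simp add: p(1) sum_distrib_left mult.assoc)
  moreover have "\<forall>s\<in>F. in_R \<B> (c * d s)" using p(4) assms(1) by (auto intro: in_R_mult)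
  ultimately show ?thesis
    unfolding ideal_gen_R_def using p(2,3)
    by (intro CollectI exI[of _ F] exI[of _ "\<lambda>s. c * d s"]) simp
qed

lemma ideal_gen_R_uminus: "p \<in> ideal_gen_R \<B> S \<Longrightarrow> - p \<in> ideal_gen_R \<B> S"
  using ideal_gen_R_mult[of \<B> "- 1" p S] by (simp add: in_R_uminus in_R_one)

lemma bnm_sym_ideal: "bnm u v \<in> ideal_gen_R \<B> S \<longleftrightarrow> bnm v u \<in> ideal_gen_R \<B> S"
  using ideal_gen_R_uminus[of "bnm u v" \<B> S] ideal_gen_R_uminus[of "bnm v u" \<B> S] by auto

lemma bnm_trans_ideal:
  "bnm u v \<in> ideal_gen_R \<B> S \<Longrightarrow> bnm v w \<in> ideal_gen_R \<B> S \<Longrightarrow> bnm u w \<in> ideal_gen_R \<B> S"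
  using ideal_gen_R_add[of "bnm u v" \<B> S "bnm v w"] by simp

lemma ideal_gen_R_sum:
  "(\<And>i. i \<in> I \<Longrightarrow> f i \<in> ideal_gen_R \<B> S) \<Longrightarrow> (\<Sum>i\<in>I. f i) \<in> ideal_gen_R \<B> S"
  by (induction I rule: infinite_finite_induct) (auto intro: ideal_gen_R_add ideal_gen_R_zero)

lemma ideal_gen_R_least:
  assumes "S \<subseteq> ideal_gen_R \<B> T"
  shows "ideal_gen_R \<B> S \<subseteq> ideal_gen_R \<B> T"
proof
  fix p assume "p \<in> ideal_gen_R \<B> S"
  then obtain F c where "p = (\<Sum>s\<in>F. c s * s)" "F \<subseteq> S" "\<forall>s\<in>F. in_R \<B> (c s)"
    unfolding ideal_gen_R_def by blast
  then show "p \<in> ideal_gen_R \<B> T"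
    using assms by (auto intro!: ideal_gen_R_sum ideal_gen_R_mult)
qed

lemma ideal_gen_R_mono: "S \<subseteq> T \<Longrightarrow> ideal_gen_R \<B> S \<subseteq> ideal_gen_R \<B> T"
  by (rule ideal_gen_R_least) (auto intro: ideal_gen_R_base)

text \<open>The certificate for non-membership: in a multiple of \<open>bnm a b\<close> the
  coefficients cancel in pairs at \<open>m + a\<close> and \<open>m + b\<close>, and both or neither
  of these lie in \<open>C\<close>. The choices for \<open>C\<close> will be a fibre of
  \<open>phi_mon\<close>, a single monomial, and a connected component of a fibre.\<close>

lemma coeff_sum_ideal:
  fixes p :: "(nat set \<Rightarrow>\<^sub>0 nat) \<Rightarrow>\<^sub>0 'k::field"
  assumes "p \<in> ideal_gen_R \<B> S"
    and "\<And>s. s \<in> S \<Longrightarrow> \<exists>a b. s = bnm a b \<and> (\<forall>m. m + a \<in> C \<longleftrightarrow> m + b \<in> C)"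
  shows "coeff_sum C p = 0"
proof -
  obtain F c where F: "p = (\<Sum>s\<in>F. c s * s)" "F \<subseteq> S"
    using assms(1) unfolding ideal_gen_R_def by blast
  have "coeff_sum C (c s * s) = 0" if "s \<in> F" for s
    using assms(2) coeff_sum_mult_bnm that F(2) by blast
  then show ?thesis by (simp add: F(1) coeff_sum_sum)
qed

text \<open>Equal monomials are allowed, which makes this an equivalence relation on the monomials
  of \<open>R\<close>; the corresponding \<open>bnm u u\<close> is 0.\<close>

definition fib :: "nat set set \<Rightarrow> (nat set \<Rightarrow>\<^sub>0 nat) \<Rightarrow> (nat set \<Rightarrow>\<^sub>0 nat) \<Rightarrow> bool" where
  "fib \<B> u v \<longleftrightarrow> Poly_Mapping.keys u \<subseteq> \<B> \<and> Poly_Mapping.keys v \<subseteq> \<B> \<and> phi_mon u = phi_mon v"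

lemma fib_sym: "fib \<B> u v \<Longrightarrow> fib \<B> v u"
  and fib_trans: "fib \<B> u v \<Longrightarrow> fib \<B> v w \<Longrightarrow> fib \<B> u w"
  by (auto simp: fib_def)

lemma toric_iff_coeff_sum:
  "p \<in> toric_ideal \<B> \<longleftrightarrow> in_R \<B> p \<and> (\<forall>t. coeff_sum {m. phi_mon m = t} p = 0)"
  by (simp add: toric_ideal_def poly_mapping_eq_iff fun_eq_iff lookup_phi)

lemma keys_bnm: "u \<noteq> v \<Longrightarrow> Poly_Mapping.keys (bnm u v :: _ \<Rightarrow>\<^sub>0 'k::field) = {u, v}"
  by (auto simp: in_keys_iff lookup_minus lookup_single when_def split: if_splits)

lemma bnm_in_toric_iff:
  assumes "u \<noteq> v"
  shows "(bnm u v :: _ \<Rightarrow>\<^sub>0 'k::field) \<in> toric_ideal \<B> \<longleftrightarrow> fib \<B> u v"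
  using assms
  by (auto simp: toric_iff_coeff_sum coeff_sum_diff coeff_sum_single fib_def in_R_def keys_bnm
      split: if_splits)

text \<open>The coefficients of \<open>p\<close> on each fibre sum to zero, so no monomial of
  \<open>p\<close> is alone in its fibre. Subtracting a multiple of \<open>bnm m m'\<close> for two
  monomials of \<open>p\<close> removes \<open>m\<close> and adds no new one.\<close>

lemma toric_subset_ideal:
  fixes S :: "((nat set \<Rightarrow>\<^sub>0 nat) \<Rightarrow>\<^sub>0 'k::field) set"
  assumes "\<And>u v. fib \<B> u v \<Longrightarrow> u \<noteq> v \<Longrightarrow> bnm u v \<in> ideal_gen_R \<B> S"
  shows "toric_ideal \<B> \<subseteq> ideal_gen_R \<B> S"
proof
  fix p :: "(nat set \<Rightarrow>\<^sub>0 nat) \<Rightarrow>\<^sub>0 'k"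
  assume "p \<in> toric_ideal \<B>"
  then show "p \<in> ideal_gen_R \<B> S"
  proof (induction "card (Poly_Mapping.keys p)" arbitrary: p rule: less_induct)
    case less
    show ?case
    proof (cases "p = 0")
      case False
      then obtain m where m: "m \<in> Poly_Mapping.keys p" by (metis ex_in_conv keys_eq_empty)
      let ?x = "Poly_Mapping.lookup p m"
      have R: "in_R \<B> p" and z: "\<And>t. coeff_sum {m. phi_mon m = t} p = 0"
        using less.prems by (auto simp: toric_iff_coeff_sum)
      have "\<exists>m'\<in>Poly_Mapping.keys p. m' \<noteq> m \<and> phi_mon m' = phi_mon m"
      proof (rule ccontr)
        assume "\<not> ?thesis"
        then have "coeff_sum {m'. phi_mon m' = phi_mon m} p =
            (\<Sum>m'\<in>Poly_Mapping.keys p. if m' = m then ?x else 0)"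
          unfolding coeff_sum_def by (intro sum.cong) auto
        then show False using m z[of "phi_mon m"] by (simp add: in_keys_iff)
      qed
      then obtain m' where m': "m' \<in> Poly_Mapping.keys p" "m' \<noteq> m" "phi_mon m' = phi_mon m" by blast
      then have f: "fib \<B> m m'" using m R by (auto simp: fib_def in_R_def)
      define d where "d = Poly_Mapping.single 0 ?x * bnm m m'"
      have d_eq: "d = Poly_Mapping.single m ?x - Poly_Mapping.single m' ?x"
        by (simp add: d_def right_diff_distrib mult_single)
      have d: "d \<in> ideal_gen_R \<B> S"
        unfolding d_def using assms[OF f] m'(2) by (intro ideal_gen_R_mult in_R_single) auto
      have "in_R \<B> d"
        unfolding d_eq using f by (intro in_R_diff in_R_single) (auto simp: fib_def)
      moreover have "coeff_sum {m. phi_mon m = t} d = 0" for t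
        using m'(3) by (simp add: d_eq coeff_sum_diff coeff_sum_single)
      ultimately have "p - d \<in> toric_ideal \<B>"
        using R z by (auto simp: toric_iff_coeff_sum coeff_sum_diff intro: in_R_diff)
      moreover have "Poly_Mapping.keys (p - d) \<subseteq> Poly_Mapping.keys p - {m}"
        using m'(1,2) by (auto simp: in_keys_iff d_eq lookup_minus lookup_single when_def split: if_splits)
      then have "card (Poly_Mapping.keys (p - d)) < card (Poly_Mapping.keys p)"
        using m by (intro psubset_card_mono) auto
      ultimately have "p - d \<in> ideal_gen_R \<B> S" using less.hyps by blast
      then show ?thesis using ideal_gen_R_add[OF _ d] by fastforce
    qed (simp add: ideal_gen_R_zero)
  qed
qed

lemma binomial_toricE:
  assumes "binomial \<B> s" "s \<in> toric_ideal \<B>"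
  obtains u v where "s = bnm u v" "u \<noteq> v" "fib \<B> u v"
  using assms bnm_in_toric_iff unfolding binomial_def by metis

lemma ideal_subset_toric:
  fixes S :: "((nat set \<Rightarrow>\<^sub>0 nat) \<Rightarrow>\<^sub>0 'k::field) set"
  assumes "S \<subseteq> toric_ideal \<B>" "\<forall>s\<in>S. binomial \<B> s"
  shows "ideal_gen_R \<B> S \<subseteq> toric_ideal \<B>"
proof
  fix p assume p: "p \<in> ideal_gen_R \<B> S"
  have "coeff_sum {m. phi_mon m = t} p = 0" for t
  proof (rule coeff_sum_ideal[OF p])
    fix s assume "s \<in> S"
    then obtain a b where "s = bnm a b" "fib \<B> a b" using assms binomial_toricE by (metis in_mono)
    then show "\<exists>a b. s = bnm a b \<and>
        (\<forall>m. m + a \<in> {m. phi_mon m = t} \<longleftrightarrow> m + b \<in> {m. phi_mon m = t})"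
      by (intro exI[of _ a] exI[of _ b]) (simp add: fib_def phi_mon_add)
  qed
  moreover have "in_R \<B> p"
    using p assms(1) unfolding ideal_gen_R_def toric_ideal_def
    by (auto intro!: in_R_sum in_R_mult)
  ultimately show "p \<in> toric_ideal \<B>" by (simp add: toric_iff_coeff_sum)
qed

lemma ideal_eq_toric_iff:
  fixes S :: "((nat set \<Rightarrow>\<^sub>0 nat) \<Rightarrow>\<^sub>0 'k::field) set"
  assumes "S \<subseteq> toric_ideal \<B>" "\<forall>s\<in>S. binomial \<B> s"
  shows "ideal_gen_R \<B> S = toric_ideal \<B> \<longleftrightarrow>
    (\<forall>u v. fib \<B> u v \<longrightarrow> bnm u v \<in> ideal_gen_R \<B> S)"
proof -
  have "bnm u v \<in> toric_ideal \<B>" if "fib \<B> u v" for u v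
    using that bnm_in_toric_iff by (cases "u = v") (auto simp: toric_iff_coeff_sum)
  then show ?thesis
    using ideal_subset_toric[OF assms] toric_subset_ideal[of \<B> S] by blast
qed

text \<open>With monomials as multisets of variables, the degree is \<open>size\<close>, and the
  factors of two monomials can be paired off.\<close>

definition mon :: "nat set multiset \<Rightarrow> nat set \<Rightarrow>\<^sub>0 nat" where
  "mon P = (\<Sum>B\<in>#P. Poly_Mapping.single B 1)"

lemma mon_empty [simp]: "mon {#} = 0"
  and mon_add_mset: "mon (add_mset B P) = Poly_Mapping.single B 1 + mon P"
  and mon_union: "mon (P + Q) = mon P + mon Q"
  by (simp_all add: mon_def)

lemma lookup_mon: "Poly_Mapping.lookup (mon P) B = count P B"
  by (induction P) (auto simp: mon_add_mset lookup_add lookup_single when_def)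

lemma keys_mon: "Poly_Mapping.keys (mon P) = set_mset P"
  by (auto simp: in_keys_iff lookup_mon)

lemma mon_inject [simp]: "mon P = mon Q \<longleftrightarrow> P = Q"
  by (metis lookup_mon multiset_eqI)

lemma mon_eq_0_iff [simp]: "mon P = 0 \<longleftrightarrow> P = {#}" "0 = mon P \<longleftrightarrow> P = {#}"
  using mon_inject[of P "{#}"] by (auto simp del: mon_inject)

lemma ex_mon: "\<exists>P. u = mon P"
proof -
  have "u = mon (\<Sum>B\<in>Poly_Mapping.keys u. replicate_mset (Poly_Mapping.lookup u B) B)"
    by (rule poly_mapping_eqI) (auto simp: lookup_mon count_sum in_keys_iff sum.delta')
  then show ?thesis ..
qed

section \<open>Generation by quadrics\<close>

lemma lookup_phi_mon_mon:
  assumes "\<forall>B\<in>#P. finite B"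
  shows "Poly_Mapping.lookup (phi_mon (mon P)) i = size {#B \<in># P. i \<in> B#}"
  using assms
proof (induction P)
  case (add B P)
  then show ?case
    using phi_mon_single[of B i] by (auto simp: mon_add_mset phi_mon_add lookup_add)
qed simp

lemma card_add_card_less:
  fixes X1 X2 Y1 Y2 U :: "'a set"
  assumes "finite U" "X1 \<subseteq> U" "X2 \<subseteq> U" "Y1 \<subseteq> U" "Y2 \<subseteq> U" "e \<in> U"
    and le: "\<And>i. of_bool (i \<in> X1) + of_bool (i \<in> X2) \<le> (of_bool (i \<in> Y1) + of_bool (i \<in> Y2) :: nat)"
    and less: "of_bool (e \<in> X1) + of_bool (e \<in> X2) < (of_bool (e \<in> Y1) + of_bool (e \<in> Y2) :: nat)"
  shows "card X1 + card X2 < card Y1 + card Y2"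
proof -
  have card: "card X = (\<Sum>i\<in>U. of_bool (i \<in> X))" if "X \<subseteq> U" for X
    using that assms(1) by (simp add: Int_absorb1)
  have "(\<Sum>i\<in>U. of_bool (i \<in> X1) + of_bool (i \<in> X2)) <
      (\<Sum>i\<in>U. of_bool (i \<in> Y1) + of_bool (i \<in> Y2) :: nat)"
    by (rule sum_strict_mono_ex1[OF assms(1)]) (use le less assms(6) in blast)+
  then show ?thesis
    by (simp only: card[OF assms(2)] card[OF assms(3)] card[OF assms(4)] card[OF assms(5)] sum.distrib)
qed

lemma card_2_memE:
  assumes "card A = 2" "a \<in> A"
  obtains y where "A = {a, y}" "y \<noteq> a"
proof -
  obtain x z where "A = {x, z}" "x \<noteq> z" using assms(1) by (meson card_2_iff)
  then show thesis using assms(2) that[of x] that[of z] by auto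
qed

lemma size_2_mset:
  assumes "size M = 2"
  shows "\<exists>X Y. M = {#X, Y#}"
proof -
  obtain X N where M: "M = add_mset X N" "size N = 1" using assms by (cases M) auto
  then obtain Y where "N = {#Y#}" using size_1_singleton_mset by (metis One_nat_def)
  then show ?thesis using M by blast
qed

context basis_system
begin

lemma fib_mon_iff:
  "fib \<B> (mon P) (mon Q) \<longleftrightarrow> set_mset P \<subseteq> \<B> \<and> set_mset Q \<subseteq> \<B> \<and>
    (\<forall>i. size {#B \<in># P. i \<in> B#} = size {#B \<in># Q. i \<in> B#})"
proof -
  have "phi_mon (mon P) = phi_mon (mon Q) \<longleftrightarrow>
      (\<forall>i. size {#B \<in># P. i \<in> B#} = size {#B \<in># Q. i \<in> B#})"
    if "set_mset P \<subseteq> \<B>" "set_mset Q \<subseteq> \<B>"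
  proof -
    have "\<forall>B\<in>#P. finite B" "\<forall>B\<in>#Q. finite B" using that finite_basis by blast+
    then show ?thesis by (simp add: poly_mapping_eq_iff fun_eq_iff lookup_phi_mon_mon)
  qed
  then show ?thesis by (auto simp: fib_def keys_mon)
qed

lemma pair_fib_iff:
  "fib \<B> (mon {#B1, B2#}) (mon {#D1, D2#}) \<longleftrightarrow>
    B1 \<in> \<B> \<and> B2 \<in> \<B> \<and> D1 \<in> \<B> \<and> D2 \<in> \<B> \<and> B1 \<inter> B2 = D1 \<inter> D2 \<and> B1 \<union> B2 = D1 \<union> D2"
proof -
  have "(size {#B \<in># {#B1, B2#}. i \<in> B#} = size {#B \<in># {#D1, D2#}. i \<in> B#}) \<longleftrightarrow>
      (i \<in> B1 \<inter> B2 \<longleftrightarrow> i \<in> D1 \<inter> D2) \<and> (i \<in> B1 \<union> B2 \<longleftrightarrow> i \<in> D1 \<union> D2)" for i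
    by auto
  then show ?thesis unfolding fib_mon_iff by (auto simp: set_eq_iff)
qed

lemma sum_size_filter:
  assumes "set_mset P \<subseteq> \<B>" "B \<in> \<B>"
  shows "(\<Sum>i\<in>{1..n}. size {#D \<in># P. i \<in> D#}) = card B * size P"
  using assms(1)
proof (induction P)
  case (add D P)
  have "(\<Sum>i\<in>{1..n}. size {#D' \<in># add_mset D P. i \<in> D'#}) =
      (\<Sum>i\<in>{1..n}. of_bool (i \<in> D) + size {#D' \<in># P. i \<in> D'#})"
    by (intro sum.cong) auto
  also have "\<dots> = card D + card B * size P"
    using add basis_subset[of D] by (simp add: sum.distrib Int_absorb1)
  finally show ?case using add.prems card_basis_eq[of D B] assms(2) by simp
qed simp

text \<open>Counting incidences, the image of a monomial has the degree of the monomial times the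
  rank, and the rank is positive as \<open>{}\<close> is not a basis.\<close>

lemma fib_size_eq:
  assumes "{} \<notin> \<B>" "fib \<B> (mon P) (mon Q)"
  shows "size P = size Q"
proof -
  note f = assms(2)[unfolded fib_mon_iff]
  obtain B where B: "B \<in> \<B>" using nonempty by blast
  have "card B > 0" using B assms(1) finite_basis by (metis card_gt_0_iff)
  moreover have "card B * size P = card B * size Q"
    using sum_size_filter[of P B] sum_size_filter[of Q B] f B by simp
  ultimately show ?thesis by simp
qed

text \<open>A move dividing a quadratic monomial has degree two, as the variables have distinct images
  (and, \<open>{}\<close> not being a basis, nonconstant ones).\<close>
lemma quadratic_move_trivial:
  assumes "{} \<notin> \<B>" "fib \<B> a b" "a \<noteq> b" "m + a = mon P" "size P = 2"
  shows "m = 0"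
proof -
  obtain A A' M where eq: "a = mon A" "b = mon A'" "m = mon M" using ex_mon by metis
  then have P: "P = M + A" using assms(4) by (simp add: mon_union[symmetric])
  note f = assms(2)[unfolded eq fib_mon_iff]
  have size: "size A = size A'" using fib_size_eq assms(1,2) eq by blast
  have "size M + size A = 2" using assms(5) P by simp
  then consider "size A = 0" | "size A = 1" | "size A = 2" by linarith
  then show ?thesis
  proof cases
    case 1
    then show ?thesis using size assms(3) eq by simp
  next
    case 2
    then obtain D D' where D: "A = {#D#}" "A' = {#D'#}"
      using size by (metis One_nat_def size_1_singleton_mset)
    have "i \<in> D \<longleftrightarrow> i \<in> D'" for i
      using f unfolding D by (auto split: if_splits dest: spec[of _ i])
    then show ?thesis using assms(3) eq D by auto
  next
    case 3
    then show ?thesis using eq P assms(5) by simp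
  qed
qed

text \<open>Both sides are decreased at \<open>e\<close>; the joint swap is needed when either single swap would
  destroy an agreement.\<close>
lemma overlap_step:
  assumes diam: "\<And>B1 B2. B1 \<in> \<B> \<Longrightarrow> B2 \<in> \<B> \<Longrightarrow> card (B1 - B2) \<le> 2"
    and B: "B1 \<in> \<B>" "B2 \<in> \<B>" "D1 \<in> \<B>" "D2 \<in> \<B>"
    and e: "e \<in> B1 - D1" "e \<in> D2 - B2"
  obtains B1' B2' D1' D2' where "fib \<B> (mon {#B1, B2#}) (mon {#B1', B2'#})"
    "fib \<B> (mon {#D1, D2#}) (mon {#D1', D2'#})"
    "card (B1' - D1') + card (B2' - D2') < card (B1 - D1) + card (B2 - D2)"
proof -
  have "e \<in> B1 - B2" "e \<in> D2 - D1" using e by auto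
  obtain c where c: "c \<in> B2 - B1" "insert c (B1 - {e}) \<in> \<B>" "insert e (B2 - {c}) \<in> \<B>"
    using symmetric_exchange[OF B(1,2) \<open>e \<in> B1 - B2\<close>] .
  obtain q where q: "q \<in> D1 - D2" "insert q (D2 - {e}) \<in> \<B>" "insert e (D1 - {q}) \<in> \<B>"
    using symmetric_exchange[OF B(4,3) \<open>e \<in> D2 - D1\<close>] .
  let ?B1 = "insert c (B1 - {e})" and ?B2 = "insert e (B2 - {c})"
    and ?D1 = "insert e (D1 - {q})" and ?D2 = "insert q (D2 - {e})"
  have fB: "fib \<B> (mon {#B1, B2#}) (mon {#?B1, ?B2#})"
    using B c e by (auto simp: pair_fib_iff)
  have fD: "fib \<B> (mon {#D1, D2#}) (mon {#?D1, ?D2#})"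
    using B q e by (auto simp: pair_fib_iff)
  have fB0: "fib \<B> (mon {#B1, B2#}) (mon {#B1, B2#})"
    and fD0: "fib \<B> (mon {#D1, D2#}) (mon {#D1, D2#})"
    and fD': "fib \<B> (mon {#D1, D2#}) (mon {#?D2, ?D1#})"
    using B fD by (auto simp: pair_fib_iff)
  note U = basis_subset[OF B(1)] basis_subset[OF B(2)] basis_subset[OF c(2)] basis_subset[OF c(3)]
  have eU: "e \<in> {1..n}" using U e by blast
  \<comment> \<open>Either exchange saves one at \<open>e\<close>. Exchanging \<open>e\<close> and
    \<open>c\<close> on the left loses it again exactly if \<open>c \<in> D2 - D1\<close>,
    exchanging \<open>e\<close> and \<open>q\<close> on the right exactly if
    \<open>q \<in> B1 - B2\<close>.\<close>
  consider "c \<notin> D2 - D1" | "q \<notin> B1 - B2" | "c \<in> D2 - D1" "q \<in> B1 - B2" by blast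
  then show thesis
  proof cases
    case 1
    have "card (?B1 - D1) + card (?B2 - D2) < card (B1 - D1) + card (B2 - D2)"
      by (rule card_add_card_less[of "{1..n}" _ _ _ _ e]) (use U eU 1 c e in auto)
    then show ?thesis using that[OF fB fD0] by blast
  next
    case 2
    have "card (B1 - ?D1) + card (B2 - ?D2) < card (B1 - D1) + card (B2 - D2)"
      by (rule card_add_card_less[of "{1..n}" _ _ _ _ e]) (use U eU 2 q e in auto)
    then show ?thesis using that[OF fB0 fD] by blast
  next
    case 3
    \<comment> \<open>By the diameter bound two known elements exhaust a difference of bases. After
      both exchanges the new sets are matched crosswise, \<open>?B1\<close> with \<open>?D2\<close>
      and \<open>?B2\<close> with \<open>?D1\<close>, which puts \<open>c\<close> and
      \<open>q\<close> into \<open>?B1\<close> and \<open>?D2\<close> alike.\<close>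
    have *: "S - T = {x, y}" if "S \<in> \<B>" "T \<in> \<B>" "x \<in> S - T" "y \<in> S - T" "x \<noteq> y" for S T x y
    proof (rule card_seteq[symmetric])
      show "card (S - T) \<le> card {x, y}" using diam[OF that(1,2)] that(5) by simp
    qed (use that finite_basis in auto)
    have "B1 - B2 = {e, q}" using *[OF B(1,2), of e q] 3 e q by blast
    moreover have "D2 - D1 = {e, c}" using *[OF B(4,3), of e c] 3 e c by blast
    ultimately have "\<And>i. i \<in> B1 \<Longrightarrow> i \<in> B2 \<or> i = e \<or> i = q" "\<And>i. i \<in> D2 \<Longrightarrow> i \<in> D1 \<or> i = e \<or> i = c"
      by blast+
    then have "card (?B1 - ?D2) + card (?B2 - ?D1) < card (B1 - D1) + card (B2 - D2)"
      by (intro card_add_card_less[of "{1..n}" _ _ _ _ e]) (use U eU 3 c q e in \<open>auto simp: of_bool_def\<close>)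
    then show ?thesis using that[OF fB fD'] by blast
  qed
qed

text \<open>Both monomials are carried by one multiset of pairs matching their factors, and the
  total distance within the pairs is the measure. A surplus \<open>e\<close> on the left of one pair
  is balanced on the right of another; \<open>overlap_step\<close> rewrites these two pairs by
  quadratic moves.\<close>

lemma fib_pairs_in_ideal:
  fixes S :: "((nat set \<Rightarrow>\<^sub>0 nat) \<Rightarrow>\<^sub>0 'k::field) set"
  assumes diam: "\<And>B1 B2. B1 \<in> \<B> \<Longrightarrow> B2 \<in> \<B> \<Longrightarrow> card (B1 - B2) \<le> 2"
    and quad: "\<And>B1 B2 D1 D2. fib \<B> (mon {#B1, B2#}) (mon {#D1, D2#}) \<Longrightarrow>
      bnm (mon {#B1, B2#}) (mon {#D1, D2#}) \<in> ideal_gen_R \<B> S"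
    and "fib \<B> (mon (image_mset fst P)) (mon (image_mset snd P))"
  shows "bnm (mon (image_mset fst P)) (mon (image_mset snd P)) \<in> ideal_gen_R \<B> S"
  using assms(3)
proof (induction "\<Sum>(B, D)\<in>#P. card (B - D)" arbitrary: P rule: less_induct)
  case less
  let ?I = "ideal_gen_R \<B> S"
  note f = less.prems[unfolded fib_mon_iff]
  then have P: "fst p \<in> \<B>" "snd p \<in> \<B>" if "p \<in># P" for p using that by auto
  show ?case
  proof (cases "\<forall>p\<in>#P. fst p \<subseteq> snd p")
    case True
    then have "image_mset fst P = image_mset snd P"
      using P basis_eqI by (intro image_mset_cong) blast
    then show ?thesis by (simp add: ideal_gen_R_zero)
  next
    case False
    then obtain p1 e where p1: "p1 \<in># P" "e \<in> fst p1" "e \<notin> snd p1" by blast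
    have sz: "size {#p \<in># P. e \<in> fst p#} = size {#p \<in># P. e \<in> snd p#}"
      using f by (simp add: filter_mset_image_mset)
    \<comment> \<open>Both sides contain \<open>e\<close> equally often. Without such a
      \<open>p2\<close>, the pairs with \<open>e\<close> on the right would be a proper part of
      those with \<open>e\<close> on the left, \<open>p1\<close> being missing.\<close>
    have "\<exists>p2\<in>#P. e \<in> snd p2 \<and> e \<notin> fst p2"
    proof (rule ccontr)
      assume "\<not> ?thesis"
      then have "{#p \<in># P. e \<in> snd p#} = {#p \<in># {#p \<in># P. e \<in> fst p#}. e \<in> snd p#}"
        by (auto simp: filter_filter_mset intro: filter_mset_cong)
      also have "\<dots> \<subset># {#p \<in># P. e \<in> fst p#}"
        using p1 by (metis (mono_tags, lifting) filter_mset_eq_conv mem_Collect_eq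
            multiset_filter_subset set_mset_filter subset_mset.le_neq_trans)
      finally show False using sz mset_subset_size by fastforce
    qed
    then obtain p2 where p2: "p2 \<in># P" "e \<in> snd p2" "e \<notin> fst p2" by blast
    obtain B1 D1 where [simp]: "p1 = (B1, D1)" by (cases p1)
    obtain B2 D2 where [simp]: "p2 = (B2, D2)" by (cases p2)
    have "p2 \<in># P - {#p1#}" using p1 p2 by (auto simp: in_diff_count)
    then obtain R where R: "P = add_mset (B1, D1) (add_mset (B2, D2) R)"
      using p1(1) by (metis \<open>p1 = (B1, D1)\<close> \<open>p2 = (B2, D2)\<close> insert_DiffM)
    obtain B1' B2' D1' D2' where s: "fib \<B> (mon {#B1, B2#}) (mon {#B1', B2'#})"
      "fib \<B> (mon {#D1, D2#}) (mon {#D1', D2'#})"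
      "card (B1' - D1') + card (B2' - D2') < card (B1 - D1) + card (B2 - D2)"
      by (rule overlap_step[of B1 B2 D1 D2 e]) (use diam P p1 p2 in auto)
    define P' where "P' = add_mset (B1', D1') (add_mset (B2', D2') R)"
    have lift: "fib \<B> (mon (add_mset X (add_mset Y Z))) (mon (add_mset X' (add_mset Y' Z)))"
        "bnm (mon (add_mset X (add_mset Y Z))) (mon (add_mset X' (add_mset Y' Z))) \<in> ?I"
      if "fib \<B> (mon {#X, Y#}) (mon {#X', Y'#})" "set_mset Z \<subseteq> \<B>" for X Y X' Y' Z
    proof -
      have split: "mon (add_mset X (add_mset Y Z)) = mon {#X, Y#} + mon Z" for X Y
        by (simp add: mon_add_mset add.assoc)
      show "fib \<B> (mon (add_mset X (add_mset Y Z))) (mon (add_mset X' (add_mset Y' Z)))"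
        using that unfolding fib_def
        by (subst (3 4) split) (simp add: phi_mon_add keys_mon)
      have "bnm (mon (add_mset X (add_mset Y Z))) (mon (add_mset X' (add_mset Y' Z))) =
          Poly_Mapping.single (mon Z) 1 * (bnm (mon {#X, Y#}) (mon {#X', Y'#}) :: _ \<Rightarrow>\<^sub>0 'k)"
        unfolding split[of X Y] split[of X' Y']
        by (simp add: right_diff_distrib mult_single add.commute)
      also have "\<dots> \<in> ?I"
        using quad[OF that(1)] that(2) by (intro ideal_gen_R_mult in_R_single) (simp_all add: keys_mon)
      finally show "bnm (mon (add_mset X (add_mset Y Z))) (mon (add_mset X' (add_mset Y' Z))) \<in> ?I" .
    qed
    have RB: "set_mset (image_mset fst R) \<subseteq> \<B>" "set_mset (image_mset snd R) \<subseteq> \<B>"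
      using P by (auto simp: R)
    have 1: "fib \<B> (mon (image_mset fst P)) (mon (image_mset fst P'))"
        "bnm (mon (image_mset fst P)) (mon (image_mset fst P')) \<in> ?I"
      using lift[OF s(1) RB(1)] by (simp_all add: R P'_def)
    have 2: "fib \<B> (mon (image_mset snd P)) (mon (image_mset snd P'))"
        "bnm (mon (image_mset snd P)) (mon (image_mset snd P')) \<in> ?I"
      using lift[OF s(2) RB(2)] by (simp_all add: R P'_def)
    have "fib \<B> (mon (image_mset fst P')) (mon (image_mset snd P'))"
      using 1(1) 2(1) less.prems fib_sym fib_trans by blast
    moreover have "(\<Sum>(B, D)\<in>#P'. card (B - D)) < (\<Sum>(B, D)\<in>#P. card (B - D))"
      using s(3) by (simp add: R P'_def)
    ultimately have "bnm (mon (image_mset fst P')) (mon (image_mset snd P')) \<in> ?I"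
      using less.hyps by blast
    then show ?thesis
      using 1(2) 2(2) bnm_sym_ideal bnm_trans_ideal by blast
  qed
qed

lemma fib_in_ideal:
  fixes S :: "((nat set \<Rightarrow>\<^sub>0 nat) \<Rightarrow>\<^sub>0 'k::field) set"
  assumes "{} \<notin> \<B>" and diam: "\<And>B1 B2. B1 \<in> \<B> \<Longrightarrow> B2 \<in> \<B> \<Longrightarrow> card (B1 - B2) \<le> 2"
    and quad: "\<And>B1 B2 D1 D2. fib \<B> (mon {#B1, B2#}) (mon {#D1, D2#}) \<Longrightarrow>
      bnm (mon {#B1, B2#}) (mon {#D1, D2#}) \<in> ideal_gen_R \<B> S"
    and "fib \<B> u v"
  shows "bnm u v \<in> ideal_gen_R \<B> S"
proof -
  obtain U V where eq: "u = mon U" "v = mon V" using ex_mon by metis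
  have size: "size U = size V" using fib_size_eq assms(1,4) eq by blast
  obtain xs ys where xy: "mset xs = U" "mset ys = V" using ex_mset by metis
  then have "length xs = length ys" using size by (metis size_mset)
  then have "image_mset fst (mset (zip xs ys)) = U" "image_mset snd (mset (zip xs ys)) = V"
    using xy by (simp_all flip: mset_map)
  then show ?thesis
    using fib_pairs_in_ideal[OF diam quad, of "mset (zip xs ys)"] assms(4) eq by simp
qed

text \<open>Quadratic fibres have at most two elements. The condition mediates between
  \<open>nu\<close> and the matroid and mentions no field, so it also shows that \<open>nu\<close>
  being 1 does not depend on the field.\<close>

definition thin :: bool where
  "thin \<longleftrightarrow> (\<forall>P v w. size P = 2 \<longrightarrow> fib \<B> (mon P) v \<longrightarrow> fib \<B> (mon P) w \<longrightarrow>
    mon P = v \<or> mon P = w \<or> v = w)"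

text \<open>The four elements \<open>e\<close>, \<open>f\<close>, \<open>g\<close>, \<open>h\<close>
  split into two pairs in three ways, and each splitting gives two bases with the same union and
  intersection.\<close>

lemma thin_imp_U24_free:
  assumes thin shows "U24_free \<B>"
  unfolding U24_free_def
proof (intro notI, elim exE conjE)
  fix B e f g h
  assume ef: "e \<in> B" "f \<in> B" "e \<noteq> f" and gh: "g \<notin> B" "h \<notin> B" "g \<noteq> h"
    and b: "B \<in> \<B>" "insert g (B - {e}) \<in> \<B>" "insert h (B - {e}) \<in> \<B>"
      "insert g (B - {f}) \<in> \<B>" "insert h (B - {f}) \<in> \<B>"
      "insert g (insert h (B - {e, f})) \<in> \<B>"
  let ?P = "{#B, insert g (insert h (B - {e, f}))#}"
    and ?Q = "{#insert g (B - {e}), insert h (B - {f})#}"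
    and ?R = "{#insert h (B - {e}), insert g (B - {f})#}"
  have "fib \<B> (mon ?P) (mon ?Q)" "fib \<B> (mon ?P) (mon ?R)"
    using b ef gh by (auto simp: pair_fib_iff)
  then have "?P = ?Q \<or> ?P = ?R \<or> ?Q = ?R"
    using assms unfolding thin_def by (metis mon_inject size_add_mset size_empty numeral_2_eq_2)
  moreover have "B \<in># ?P" "B \<notin># ?Q" "B \<notin># ?R" using gh by auto
  moreover have "g \<in> insert g (B - {e})" "h \<notin> insert g (B - {e})" "e \<notin> insert g (B - {e})"
    "e \<in> insert g (B - {f})" "h \<in> insert h (B - {e})"
    using ef gh by auto
  then have "insert g (B - {e}) \<in># ?Q" "insert g (B - {e}) \<notin># ?R" by auto
  ultimately show False by metis
qed

lemma thin_imp_card_Diff_le: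
  assumes thin and B: "B1 \<in> \<B>" "B2 \<in> \<B>"
  shows "card (B1 - B2) \<le> 2"
proof (rule ccontr)
  assume big: "\<not> card (B1 - B2) \<le> 2"
  have small: "\<not> B1 - B2 \<subseteq> {x, y}" for x y
    using big card_mono[of "{x, y}" "B1 - B2"] by (auto simp: card_insert_if split: if_splits)
  obtain e where e: "e \<in> B1 - B2" using small by blast
  obtain f where f: "f \<in> B1 - B2" "f \<noteq> e" using small by blast
  obtain c where c: "c \<in> B2 - B1" "insert c (B1 - {e}) \<in> \<B>" "insert e (B2 - {c}) \<in> \<B>"
    using symmetric_exchange[OF B e] .
  obtain d where d: "d \<in> B2 - B1" "insert d (B1 - {f}) \<in> \<B>" "insert f (B2 - {d}) \<in> \<B>"
    using symmetric_exchange[OF B f(1)] .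
  let ?P = "{#B1, B2#}" and ?Q = "{#insert c (B1 - {e}), insert e (B2 - {c})#}"
    and ?R = "{#insert d (B1 - {f}), insert f (B2 - {d})#}"
  have "fib \<B> (mon ?P) (mon ?Q)" "fib \<B> (mon ?P) (mon ?R)"
    using B c d e f by (auto simp: pair_fib_iff)
  then have "?P = ?Q \<or> ?P = ?R \<or> ?Q = ?R"
    using assms(1) unfolding thin_def by (metis mon_inject size_add_mset size_empty numeral_2_eq_2)
  \<comment> \<open>Multisets forget order, so a coincidence could also be crosswise. Each of these
    would confine \<open>B1 - B2\<close> to \<open>{e, f}\<close>; this is where distance three is
    used.\<close>
  moreover have "B1 \<noteq> insert e (B2 - {c})" "B1 \<noteq> insert f (B2 - {d})" "insert c (B1 - {e}) \<noteq> insert f (B2 - {d})"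
    using small[of e e] small[of f f] small[of e f] by blast+
  moreover have "B1 \<noteq> insert c (B1 - {e})" "B1 \<noteq> insert d (B1 - {f})"
    using c d by blast+
  moreover have "f \<in> insert c (B1 - {e})" "f \<notin> insert d (B1 - {f})" using d f by auto
  then have "insert c (B1 - {e}) \<noteq> insert d (B1 - {f})" by metis
  ultimately have "B1 \<in># ?P" "B1 \<notin># ?Q" "B1 \<notin># ?R" "insert c (B1 - {e}) \<in># ?Q" "insert c (B1 - {e}) \<notin># ?R"
    "?P = ?Q \<or> ?P = ?R \<or> ?Q = ?R"
    by auto
  then show False by metis
qed

text \<open>Sets \<open>D1\<close>, \<open>D2\<close> with the given union and intersection are
  determined by \<open>D1 - D2\<close>, which has the size of \<open>B1 - B2\<close>. With
  \<open>a\<close> placed in the first set, at most one further element is free, and choosing it in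
  \<open>B1\<close> gives back the original pair.\<close>

lemma pair_fib_cases:
  assumes "fib \<B> (mon {#B1, B2#}) (mon {#D1, D2#})" "a \<in> B1 - B2" "card (B1 - B2) \<le> 2"
  obtains "{#D1, D2#} = {#B1, B2#}"
  | y where "y \<in> B2 - B1" "{#D1, D2#} = {#(B1 \<inter> B2) \<union> {a, y}, (B1 \<union> B2) - {a, y}#}" "card (B1 - B2) = 2"
proof -
  have main: "{#D1, D2#} = {#B1, B2#} \<or>
      (\<exists>y\<in>B2 - B1. {#D1, D2#} = {#(B1 \<inter> B2) \<union> {a, y}, (B1 \<union> B2) - {a, y}#} \<and> card (B1 - B2) = 2)"
    if f: "fib \<B> (mon {#B1, B2#}) (mon {#D1, D2#})" and "a \<in> D1" for D1 D2
  proof -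
    have b: "B1 \<in> \<B>" "B2 \<in> \<B>" "D1 \<in> \<B>" "D2 \<in> \<B>" and eq: "B1 \<inter> B2 = D1 \<inter> D2" "B1 \<union> B2 = D1 \<union> D2"
      using f by (auto simp: pair_fib_iff)
    note fin = finite_basis[OF b(1)] finite_basis[OF b(3)]
    have a: "a \<in> D1 - D2" using assms(2) eq \<open>a \<in> D1\<close> by blast
    have card: "card (D1 - D2) = card (B1 - B2)"
      using fin eq(1) card_basis_eq[OF b(1,3)] by (simp add: card_Diff_subset_Int)
    have D1: "D1 = (B1 \<inter> B2) \<union> (D1 - D2)" and D2: "D2 = (B1 \<union> B2) - (D1 - D2)" using eq by auto
    have "card (B1 - B2) \<noteq> 0" using assms(2) fin by auto
    then consider "card (B1 - B2) = 1" | "card (B1 - B2) = 2" using assms(3) by linarith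
    then show ?thesis
    proof cases
      case 1
      then have "B1 - B2 = {a}" "D1 - D2 = {a}"
        using card a assms(2) by (metis card_1_singletonE singletonD)+
      then have "D1 = B1" "D2 = B2" using D1 D2 by blast+
      then show ?thesis by simp
    next
      case 2
      obtain y where y: "D1 - D2 = {a, y}" "y \<noteq> a"
        using card a 2 card_2_memE by metis
      show ?thesis
      proof (cases "y \<in> B2 - B1")
        case True
        then show ?thesis using y D1 D2 2 by (intro disjI2 bexI[of _ y]) auto
      next
        case False
        have "y \<in> D1 - D2" using y by blast
        then have "y \<in> B1 - B2" using False eq by blast
        then have "{a, y} = B1 - B2"
          using 2 y(2) assms(2) fin by (intro card_subset_eq) auto
        then have "D1 = B1" "D2 = B2" using D1 D2 y by auto
        then show ?thesis by simp
      qed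
    qed
  qed
  show thesis
  proof (cases "a \<in> D1")
    case True
    then show ?thesis using main[OF assms(1)] that by blast
  next
    case False
    then have "a \<in> D2" using assms(1,2) by (auto simp: pair_fib_iff)
    moreover have "{#D1, D2#} = {#D2, D1#}" by simp
    ultimately show ?thesis using main[of D2 D1] assms(1) that by metis
  qed
qed

text \<open>Three monomials in a fibre realise all three ways to split a four-element symmetric
  difference into pairs, with \<open>y\<close> and \<open>z\<close> as partners of \<open>a\<close>
  in the two new ones. Their six factors form the excluded configuration.\<close>

lemma thinI:
  assumes "{} \<notin> \<B>" "U24_free \<B>"
    and diam: "\<And>B1 B2. B1 \<in> \<B> \<Longrightarrow> B2 \<in> \<B> \<Longrightarrow> card (B1 - B2) \<le> 2"
  shows thin
  unfolding thin_def
proof (intro allI impI, rule ccontr)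
  fix P v w
  assume P: "size P = 2" and v: "fib \<B> (mon P) v" and w: "fib \<B> (mon P) w"
    and distinct: "\<not> (mon P = v \<or> mon P = w \<or> v = w)"
  obtain V W where eq: "v = mon V" "w = mon W" using ex_mon by metis
  have "size V = 2" "size W = 2"
    using fib_size_eq[OF assms(1)] v w P eq by metis+
  then obtain B1 B2 D1 D2 E1 E2 where
    PVW: "P = {#B1, B2#}" "V = {#D1, D2#}" "W = {#E1, E2#}"
    using size_2_mset P by metis
  note v = v[unfolded PVW eq] and w = w[unfolded PVW eq]
  have b: "B1 \<in> \<B>" "B2 \<in> \<B>" using v by (auto simp: pair_fib_iff)
  have "B1 - B2 \<noteq> {}"
  proof
    assume "B1 - B2 = {}"
    then have "B1 = B2" using b basis_eqI by blast
    then have "D1 = B1" "D2 = B1" using v unfolding pair_fib_iff by blast+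
    then show False using distinct eq PVW \<open>B1 = B2\<close> by simp
  qed
  then obtain a where a: "a \<in> B1 - B2" by blast
  from pair_fib_cases[OF v a diam[OF b]] obtain y where y: "y \<in> B2 - B1" "card (B1 - B2) = 2"
    "V = {#(B1 \<inter> B2) \<union> {a, y}, (B1 \<union> B2) - {a, y}#}"
    using distinct eq PVW by metis
  from pair_fib_cases[OF w a diam[OF b]] obtain z where z: "z \<in> B2 - B1"
    "W = {#(B1 \<inter> B2) \<union> {a, z}, (B1 \<union> B2) - {a, z}#}"
    using distinct eq PVW by metis
  have "y \<noteq> z" using distinct eq y z by auto
  have "card (B2 - B1) = 2" using card_Diff_basis_commute b y(2) by metis
  then have B21: "B2 - B1 = {y, z}"
    using y(1) z(1) \<open>y \<noteq> z\<close> finite_basis[OF b(2)] by (intro card_subset_eq[symmetric]) auto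
  obtain b' where b': "B1 - B2 = {a, b'}" "b' \<noteq> a"
    using card_2_memE[OF y(2) a] .
  have *: "X \<in> \<B>" if "X \<in># V \<or> X \<in># W" for X
    using that v w PVW eq by (auto simp: pair_fib_iff)
  have "insert y (B1 - {a}) = (B1 \<union> B2) - {a, z}" "insert z (B1 - {a}) = (B1 \<union> B2) - {a, y}"
    "insert y (B1 - {b'}) = (B1 \<inter> B2) \<union> {a, y}" "insert z (B1 - {b'}) = (B1 \<inter> B2) \<union> {a, z}"
    "insert y (insert z (B1 - {a, b'})) = B2"
    using b' B21 \<open>y \<noteq> z\<close> by blast+
  then have "insert y (B1 - {a}) \<in> \<B>" "insert z (B1 - {a}) \<in> \<B>" "insert y (B1 - {b'}) \<in> \<B>"
    "insert z (B1 - {b'}) \<in> \<B>" "insert y (insert z (B1 - {a, b'})) \<in> \<B>"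
    using * y(3) z(2) b by auto
  moreover have "a \<in> B1" "b' \<in> B1" "a \<noteq> b'" "y \<notin> B1" "z \<notin> B1" using b' y z by auto
  ultimately show False
    using assms(2) b(1) \<open>y \<noteq> z\<close> unfolding U24_free_def by blast
qed

end

section \<open>Minimal generating sets\<close>

lemma bnm_toric_binomial:
  assumes "fib \<B> u v" "u \<noteq> v"
  shows "(bnm u v :: _ \<Rightarrow>\<^sub>0 'k::field) \<in> toric_ideal \<B>" "binomial \<B> (bnm u v :: _ \<Rightarrow>\<^sub>0 'k::field)"
proof -
  show "(bnm u v :: _ \<Rightarrow>\<^sub>0 'k) \<in> toric_ideal \<B>" using assms bnm_in_toric_iff by metis
  show "binomial \<B> (bnm u v :: _ \<Rightarrow>\<^sub>0 'k)"
    unfolding binomial_def using assms by (intro exI[of _ u] exI[of _ v]) (simp add: fib_def)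
qed

context basis_system
begin

text \<open>The functional \<open>coeff_sum {mon P}\<close> is 1 on \<open>bnm (mon P) v\<close>. By
  \<open>quadratic_move_trivial\<close> a generator can reach \<open>mon P\<close> only with a
  constant multiplier, so some generator must have \<open>mon P\<close> as a term.\<close>

lemma isolated_monomial:
  fixes S :: "((nat set \<Rightarrow>\<^sub>0 nat) \<Rightarrow>\<^sub>0 'k::field) set"
  assumes "{} \<notin> \<B>" and S: "S \<subseteq> toric_ideal \<B>" "\<forall>s\<in>S. binomial \<B> s"
    and P: "size P = 2" and v: "bnm (mon P) v \<in> ideal_gen_R \<B> S" "mon P \<noteq> v"
  obtains b where "b \<noteq> mon P" "fib \<B> (mon P) b" "bnm (mon P) b \<in> S \<or> bnm b (mon P) \<in> S"
proof (rule ccontr)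
  assume not: "\<not> thesis"
  have "coeff_sum {mon P} (bnm (mon P) v :: _ \<Rightarrow>\<^sub>0 'k) = 0"
  proof (rule coeff_sum_ideal[OF v(1)])
    fix s assume s: "s \<in> S"
    then obtain a b where ab: "s = bnm a b" "a \<noteq> b" "fib \<B> a b"
      using S binomial_toricE by (metis in_mono)
    have "m + a \<noteq> mon P" for m
    proof
      assume eq: "m + a = mon P"
      then have "m = 0" using quadratic_move_trivial[OF assms(1) ab(3,2) _ P] by blast
      then show False using not that[of b] eq ab s by auto
    qed
    moreover have "m + b \<noteq> mon P" for m
    proof
      assume eq: "m + b = mon P"
      then have "m = 0"
        using quadratic_move_trivial[OF assms(1) fib_sym[OF ab(3)] _ _ P] ab(2) by blast
      then show False using not that[of a] eq ab s fib_sym by auto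
    qed
    ultimately show "\<exists>a b. s = bnm a b \<and> (\<forall>m. m + a \<in> {mon P} \<longleftrightarrow> m + b \<in> {mon P})"
      using ab(1) by (intro exI[of _ a] exI[of _ b]) simp
  qed
  then show False using v(2) by (simp add: coeff_sum_diff coeff_sum_single)
qed

definition quadratic_pairs :: "((nat set \<Rightarrow>\<^sub>0 nat) \<times> (nat set \<Rightarrow>\<^sub>0 nat)) set" where
  "quadratic_pairs = {(u, v). u \<noteq> v \<and> fib \<B> u v \<and> (\<exists>P. size P = 2 \<and> u = mon P)}"

lemma finite_quadratic_pairs:
  assumes "{} \<notin> \<B>" shows "finite quadratic_pairs"
proof (rule finite_subset)
  let ?M = "(\<lambda>(X, Y). mon {#X, Y#}) ` (\<B> \<times> \<B>)"
  have M: "mon P \<in> ?M" if P: "size P = 2" "set_mset P \<subseteq> \<B>" for P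
  proof -
    obtain X Y where "P = {#X, Y#}" using size_2_mset[OF P(1)] by blast
    then show ?thesis using P(2) by auto
  qed
  show "quadratic_pairs \<subseteq> ?M \<times> ?M"
  proof safe
    fix u v assume "(u, v) \<in> quadratic_pairs"
    then obtain P where P: "size P = 2" "u = mon P" "fib \<B> u v" by (auto simp: quadratic_pairs_def)
    obtain Q where Q: "v = mon Q" using ex_mon by blast
    have "size Q = 2" using fib_size_eq[OF assms, of P Q] P Q by simp
    moreover have "set_mset P \<subseteq> \<B>" "set_mset Q \<subseteq> \<B>" using P Q fib_mon_iff by blast+
    ultimately show "u \<in> ?M" "v \<in> ?M" using M P(1,2) Q by blast+
  qed
  show "finite (?M \<times> ?M)" using finite_bases by simp
qed

lemma quadratic_generators:
  fixes S :: "((nat set \<Rightarrow>\<^sub>0 nat) \<Rightarrow>\<^sub>0 'k::field) set"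
  assumes "{} \<notin> \<B>" and diam: "\<And>B1 B2. B1 \<in> \<B> \<Longrightarrow> B2 \<in> \<B> \<Longrightarrow> card (B1 - B2) \<le> 2"
    and S: "S \<subseteq> toric_ideal \<B>" "\<forall>s\<in>S. binomial \<B> s"
    and quad: "\<And>u v. (u, v) \<in> quadratic_pairs \<Longrightarrow> bnm u v \<in> S \<or> bnm v u \<in> S"
  shows "ideal_gen_R \<B> S = toric_ideal \<B>"
proof -
  have "bnm (mon {#B1, B2#}) (mon {#D1, D2#}) \<in> ideal_gen_R \<B> S"
    if f: "fib \<B> (mon {#B1, B2#}) (mon {#D1, D2#})" for B1 B2 D1 D2
  proof (cases "mon {#B1, B2#} = mon {#D1, D2#}")
    case False
    have "size {#B1, B2#} = 2" by simp
    then have "(mon {#B1, B2#}, mon {#D1, D2#}) \<in> quadratic_pairs"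
      using f False unfolding quadratic_pairs_def by blast
    then show ?thesis using quad ideal_gen_R_base bnm_sym_ideal by metis
  qed (simp add: ideal_gen_R_zero)
  then show ?thesis
    using fib_in_ideal[OF assms(1) diam] ideal_eq_toric_iff[OF S] by blast
qed

text \<open>In a thin fibre \<open>u\<close> has one possible partner, so
  \<open>isolated_monomial\<close> forces every quadratic binomial into \<open>S\<close> up to sign.
  These already generate, so minimality excludes all others.\<close>

lemma minimal_gens_keys:
  fixes S :: "((nat set \<Rightarrow>\<^sub>0 nat) \<Rightarrow>\<^sub>0 'k::field) set"
  assumes "{} \<notin> \<B>" thin and diam: "\<And>B1 B2. B1 \<in> \<B> \<Longrightarrow> B2 \<in> \<B> \<Longrightarrow> card (B1 - B2) \<le> 2"
    and min: "minimal_binomial_gens \<B> S"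
  shows "Poly_Mapping.keys ` S = (\<lambda>(u, v). {u, v}) ` quadratic_pairs"
proof -
  let ?K = "(\<lambda>(u, v). {u, v}) ` quadratic_pairs"
  have S: "S \<subseteq> toric_ideal \<B>" "\<forall>s\<in>S. binomial \<B> s" "ideal_gen_R \<B> S = toric_ideal \<B>"
    and Smin: "\<And>T. T \<subset> S \<Longrightarrow> ideal_gen_R \<B> T \<noteq> toric_ideal \<B>"
    using min unfolding minimal_binomial_gens_def by auto
  have quad: "bnm u v \<in> S \<or> bnm v u \<in> S" if uv: "(u, v) \<in> quadratic_pairs" for u v
  proof -
    obtain P where P: "size P = 2" "u = mon P" "u \<noteq> v" "fib \<B> u v"
      using uv by (auto simp: quadratic_pairs_def)
    then have "bnm (mon P) v \<in> ideal_gen_R \<B> S" using S(3) bnm_in_toric_iff by blast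
    from isolated_monomial[OF assms(1) S(1,2) P(1) this] P obtain b where
      b: "b \<noteq> u" "fib \<B> u b" "bnm u b \<in> S \<or> bnm b u \<in> S" by blast
    then have "b = v" using assms(2) P unfolding thin_def by metis
    then show ?thesis using b by simp
  qed
  define T where "T = {s \<in> S. Poly_Mapping.keys s \<in> ?K}"
  have quadT: "bnm u v \<in> T \<or> bnm v u \<in> T" if uv: "(u, v) \<in> quadratic_pairs" for u v
  proof -
    have K: "{u, v} \<in> ?K" "{v, u} \<in> ?K" using uv by force+
    have "u \<noteq> v" using uv by (auto simp: quadratic_pairs_def)
    then have "Poly_Mapping.keys (bnm u v :: _ \<Rightarrow>\<^sub>0 'k) \<in> ?K" "Poly_Mapping.keys (bnm v u :: _ \<Rightarrow>\<^sub>0 'k) \<in> ?K"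
      using K keys_bnm by metis+
    then show ?thesis using quad[OF uv] by (auto simp: T_def)
  qed
  have "T \<subseteq> S" by (auto simp: T_def)
  then have "ideal_gen_R \<B> T = toric_ideal \<B>"
    using S(1,2) quadT by (intro quadratic_generators[OF assms(1) diam]) auto
  then have "T = S" using Smin \<open>T \<subseteq> S\<close> by blast
  show ?thesis
  proof
    show "Poly_Mapping.keys ` S \<subseteq> ?K" using \<open>T = S\<close> T_def by blast
    show "?K \<subseteq> Poly_Mapping.keys ` S"
    proof safe
      fix u v assume uv: "(u, v) \<in> quadratic_pairs"
      then have "u \<noteq> v" by (auto simp: quadratic_pairs_def)
      then show "{u, v} \<in> Poly_Mapping.keys ` S"
        using quad[OF uv] keys_bnm[of u v] keys_bnm[of v u] by (metis image_eqI insert_commute)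
    qed
  qed
qed

lemma ex_minimal_gens:
  assumes "{} \<notin> \<B>" and diam: "\<And>B1 B2. B1 \<in> \<B> \<Longrightarrow> B2 \<in> \<B> \<Longrightarrow> card (B1 - B2) \<le> 2"
  shows "\<exists>S :: ((nat set \<Rightarrow>\<^sub>0 nat) \<Rightarrow>\<^sub>0 'k::field) set. minimal_binomial_gens \<B> S"
proof -
  define S :: "((nat set \<Rightarrow>\<^sub>0 nat) \<Rightarrow>\<^sub>0 'k) set" where "S = (\<lambda>(u, v). bnm u v) ` quadratic_pairs"
  have fin: "finite S" using finite_quadratic_pairs[OF assms(1)] by (simp add: S_def)
  have S: "S \<subseteq> toric_ideal \<B>" "\<forall>s\<in>S. binomial \<B> s"
    using bnm_toric_binomial unfolding S_def quadratic_pairs_def by fast+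
  have "ideal_gen_R \<B> S = toric_ideal \<B>"
    by (rule quadratic_generators[OF assms(1) diam S]) (auto simp: S_def)
  then have ne: "{T. T \<subseteq> S \<and> ideal_gen_R \<B> T = toric_ideal \<B>} \<noteq> {}" by blast
  have "finite {T. T \<subseteq> S \<and> ideal_gen_R \<B> T = toric_ideal \<B>}"
    using fin by (auto intro: finite_subset[of _ "Pow S"])
  \<comment> \<open>Unless the characteristic is two, \<open>S\<close> contains each of its
    binomials with both signs, so a minimal subset has to be selected.\<close>
  from finite_has_minimal[OF this ne] obtain T where T: "T \<subseteq> S" "ideal_gen_R \<B> T = toric_ideal \<B>"
    and min: "\<forall>T'\<in>{T. T \<subseteq> S \<and> ideal_gen_R \<B> T = toric_ideal \<B>}. T' \<subseteq> T \<longrightarrow> T = T'"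
    by auto
  have "ideal_gen_R \<B> T' \<noteq> toric_ideal \<B>" if "T' \<subset> T" for T'
    using min T(1) that by auto
  then have "minimal_binomial_gens \<B> T"
    using S T unfolding minimal_binomial_gens_def by auto
  then show ?thesis ..
qed

text \<open>Within a quadratic fibre a minimal generating set is a spanning tree, and any other spanning
  tree does as well; stars have the advantage that every edge visibly isolates a vertex.\<close>
lemma star_minimal:
  fixes S :: "((nat set \<Rightarrow>\<^sub>0 nat) \<Rightarrow>\<^sub>0 'k::field) set"
  assumes "{} \<notin> \<B>" "minimal_binomial_gens \<B> S" "size P = 2" "fib \<B> (mon P) c"
  shows "minimal_binomial_gens \<B>
    ({s \<in> S. \<not> Poly_Mapping.keys s \<subseteq> {x. fib \<B> (mon P) x}} \<union> {bnm c x | x. fib \<B> (mon P) x \<and> x \<noteq> c})"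
proof -
  define F where "F = {x. fib \<B> (mon P) x}"
  define A where "A = {s \<in> S. \<not> Poly_Mapping.keys s \<subseteq> F}"
  define E where "E = {s \<in> S. Poly_Mapping.keys s \<subseteq> F}"
  define star :: "((nat set \<Rightarrow>\<^sub>0 nat) \<Rightarrow>\<^sub>0 'k) set" where "star = {bnm c x | x. x \<in> F \<and> x \<noteq> c}"
  have S: "S \<subseteq> toric_ideal \<B>" "\<forall>s\<in>S. binomial \<B> s" "ideal_gen_R \<B> S = toric_ideal \<B>"
    and Smin: "\<And>T. T \<subset> S \<Longrightarrow> ideal_gen_R \<B> T \<noteq> toric_ideal \<B>"
    using assms(2) unfolding minimal_binomial_gens_def by auto
  have SE: "\<exists>a b. s = bnm a b \<and> a \<noteq> b \<and> fib \<B> a b" if "s \<in> S" for s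
    using that S binomial_toricE by (metis in_mono)
  have c: "c \<in> F" using assms(4) by (simp add: F_def)
  have F: "fib \<B> x y" if "x \<in> F" "y \<in> F" for x y
    using that fib_sym fib_trans unfolding F_def by blast
  have F_closed: "y \<in> F" if "x \<in> F" "fib \<B> x y" for x y
    using that fib_trans unfolding F_def by blast
  have F_mon: "\<exists>Q. x = mon Q \<and> size Q = 2" if "x \<in> F" for x
  proof -
    obtain Q where "x = mon Q" using ex_mon by blast
    moreover from this have "size Q = 2"
      using fib_size_eq[OF assms(1), of P Q] that assms(3) by (simp add: F_def)
    ultimately show ?thesis by blast
  qed
  have F_move: "m = 0" if "m + a \<in> F" "fib \<B> a b" "a \<noteq> b" for m a b
    using F_mon[OF that(1)] quadratic_move_trivial[OF assms(1) that(2,3)] by blast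
  have star_toric: "star \<subseteq> toric_ideal \<B>" "\<forall>s\<in>star. binomial \<B> s"
    using F[OF c] bnm_toric_binomial unfolding star_def by fast+
  have star_E: "star \<subseteq> ideal_gen_R \<B> E"
  proof
    fix s assume "s \<in> star"
    then obtain x where x: "s = bnm c x" "x \<in> F" "x \<noteq> c" by (auto simp: star_def)
    \<comment> \<open>This plays the role of the connected component of \<open>c\<close> under the
      edges from \<open>S\<close>. It is closed under all moves of \<open>S\<close>, so
      \<open>coeff_sum C\<close> vanishes on the ideal and \<open>x\<close> cannot lie
      outside.\<close>
    define C where "C = {z \<in> F. (bnm c z :: _ \<Rightarrow>\<^sub>0 'k) \<in> ideal_gen_R \<B> E}"
    have closed: "m + b \<in> C" if "m + a \<in> C" "fib \<B> a b" "a \<noteq> b" "bnm a b \<in> S \<or> bnm b a \<in> S" for m a b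
    proof -
      have "m = 0" using F_move that by (auto simp: C_def)
      then have a: "a \<in> F" "bnm c a \<in> ideal_gen_R \<B> E" using that(1) by (auto simp: C_def)
      have b: "b \<in> F" using F_closed a that(2) by blast
      have "bnm a b \<in> E \<or> bnm b a \<in> E"
        using that(3,4) a(1) b keys_bnm[of a b] keys_bnm[of b a] by (auto simp: E_def)
      then have "bnm a b \<in> ideal_gen_R \<B> E" using ideal_gen_R_base bnm_sym_ideal by metis
      then show ?thesis using a(2) b \<open>m = 0\<close> bnm_trans_ideal by (auto simp: C_def)
    qed
    have "bnm c x \<in> ideal_gen_R \<B> S"
      using S(3) F[OF c x(2)] x(3) bnm_in_toric_iff by metis
    then have "coeff_sum C (bnm c x :: _ \<Rightarrow>\<^sub>0 'k) = 0"
    proof (rule coeff_sum_ideal)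
      fix s assume s: "s \<in> S"
      obtain a b where ab: "s = bnm a b" "a \<noteq> b" "fib \<B> a b" using SE[OF s] by blast
      then show "\<exists>a b. s = bnm a b \<and> (\<forall>m. m + a \<in> C \<longleftrightarrow> m + b \<in> C)"
        using closed[of _ a b] closed[of _ b a] fib_sym s by metis
    qed
    moreover have "c \<in> C" using c by (simp add: C_def ideal_gen_R_zero)
    ultimately have "x \<in> C" by (auto simp: coeff_sum_diff coeff_sum_single split: if_splits)
    then show "s \<in> ideal_gen_R \<B> E" by (simp add: C_def x(1))
  qed
  have sub: "A \<union> star \<subseteq> toric_ideal \<B>" and bin: "\<forall>s\<in>A \<union> star. binomial \<B> s"
    using S(1,2) star_toric by (auto simp: A_def)
  have "S \<subseteq> ideal_gen_R \<B> (A \<union> star)"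
  proof
    fix s assume s: "s \<in> S"
    show "s \<in> ideal_gen_R \<B> (A \<union> star)"
    proof (cases "s \<in> A")
      case False
      obtain a b where ab: "s = bnm a b" "a \<noteq> b" using SE[OF s] by blast
      then have "a \<in> F" "b \<in> F" using False s keys_bnm[of a b] by (auto simp: A_def)
      have cx: "bnm c x \<in> ideal_gen_R \<B> (A \<union> star)" if "x \<in> F" for x
        using that ideal_gen_R_base[of "bnm c x" "A \<union> star"]
        by (cases "x = c") (auto simp: star_def ideal_gen_R_zero)
      show ?thesis
        using cx[OF \<open>a \<in> F\<close>] cx[OF \<open>b \<in> F\<close>] ab(1) bnm_sym_ideal bnm_trans_ideal by metis
    qed (auto intro: ideal_gen_R_base)
  qed
  then have gen: "ideal_gen_R \<B> (A \<union> star) = toric_ideal \<B>"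
    using ideal_gen_R_least ideal_subset_toric[OF sub bin] S(3) by blast
  have "ideal_gen_R \<B> T \<noteq> toric_ideal \<B>" if TA: "T \<subset> A \<union> star" for T
  proof
    assume T: "ideal_gen_R \<B> T = toric_ideal \<B>"
    have T': "T \<subseteq> toric_ideal \<B>" "\<forall>s\<in>T. binomial \<B> s" using TA sub bin by blast+
    obtain s where s: "s \<in> A \<union> star" "s \<notin> T" using TA by blast
    show False
    proof (cases "s \<in> A")
      case True
      \<comment> \<open>As \<open>s\<close> lies outside the fibre, the edges in \<open>E\<close>
        survive its removal and recover the star; then \<open>S - {s}\<close> would already
        generate.\<close>
      have "E \<subseteq> S - {s}" using True by (auto simp: A_def E_def)
      then have "star \<subseteq> ideal_gen_R \<B> (S - {s})" using star_E ideal_gen_R_mono by blast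
      moreover have "T - star \<subseteq> S - {s}" using TA s(2) by (auto simp: A_def)
      ultimately have "T \<subseteq> ideal_gen_R \<B> (S - {s})" using ideal_gen_R_base by blast
      then have "toric_ideal \<B> \<subseteq> ideal_gen_R \<B> (S - {s})" using T ideal_gen_R_least by blast
      moreover have "ideal_gen_R \<B> (S - {s}) \<subseteq> toric_ideal \<B>"
        using S(3) ideal_gen_R_mono by blast
      moreover have "S - {s} \<subset> S" using True by (auto simp: A_def)
      ultimately show False using Smin by blast
    next
      case False
      then obtain x where x: "s = bnm c x" "x \<in> F" "x \<noteq> c" using s(1) by (auto simp: star_def)
      obtain Q where Q: "x = mon Q" "size Q = 2" using F_mon[OF x(2)] by blast
      have "bnm (mon Q) c \<in> ideal_gen_R \<B> T" "mon Q \<noteq> c"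
        using T F[OF x(2) c] x(3) Q(1) bnm_in_toric_iff by metis+
      \<comment> \<open>Some element of \<open>T\<close> must still have \<open>x\<close> as a term.
        It is supported in the fibre, hence is a star edge, and the star joins \<open>x\<close> to
        \<open>c\<close> alone, so it is the missing one.\<close>
      from isolated_monomial[OF assms(1) T' Q(2) this] obtain b where
        b: "b \<noteq> x" "fib \<B> x b" "bnm x b \<in> T \<or> bnm b x \<in> T" using Q(1) by blast
      have "Poly_Mapping.keys (bnm x b :: _ \<Rightarrow>\<^sub>0 'k) = {x, b}"
        "Poly_Mapping.keys (bnm b x :: _ \<Rightarrow>\<^sub>0 'k) = {x, b}"
        using b(1) by (simp_all add: keys_bnm insert_commute)
      then obtain t where t: "t \<in> T" "Poly_Mapping.keys t = {x, b}"
        using b(3) by metis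
      have "b \<in> F" using F_closed x(2) b(2) by blast
      then have "t \<notin> A" using t(2) x(2) by (simp add: A_def)
      then obtain y where y: "t = bnm c y" "y \<noteq> c" using TA t(1) by (auto simp: star_def)
      then have "Poly_Mapping.keys t = {c, y}" by (simp add: keys_bnm)
      then have "{c, y} = {x, b}" using t(2) by simp
      then have "y = x" using x(3) by blast
      then show False using t(1) s(2) x(1) y(1) by simp
    qed
  qed
  then show ?thesis
    using sub bin gen unfolding minimal_binomial_gens_def A_def star_def F_def by simp
qed

text \<open>If a fibre has three monomials, the star centred at \<open>v\<close> contains the edge
  from \<open>v\<close> to \<open>w\<close>, whereas every edge of the star centred at
  \<open>mon P\<close> meets \<open>mon P\<close>; the two minimal sets thus have different
  supports.\<close>

lemma nu_eq_1_iff: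
  assumes "{} \<notin> \<B>"
  shows "nu TYPE('k::field) \<B> = 1 \<longleftrightarrow> thin"
proof
  assume thin
  note diam = thin_imp_card_Diff_le[OF this]
  obtain S :: "((nat set \<Rightarrow>\<^sub>0 nat) \<Rightarrow>\<^sub>0 'k) set" where "minimal_binomial_gens \<B> S"
    using ex_minimal_gens[OF assms diam] by blast
  moreover have "Poly_Mapping.keys ` T = (\<lambda>(u, v). {u, v}) ` quadratic_pairs"
    if "minimal_binomial_gens \<B> T" for T :: "((nat set \<Rightarrow>\<^sub>0 nat) \<Rightarrow>\<^sub>0 'k) set"
    by (rule minimal_gens_keys[OF assms \<open>thin\<close> diam that])
  ultimately have "{(Poly_Mapping.keys ` S) | S :: ((nat set \<Rightarrow>\<^sub>0 nat) \<Rightarrow>\<^sub>0 'k) set.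
      minimal_binomial_gens \<B> S} = {(\<lambda>(u, v). {u, v}) ` quadratic_pairs}"
    unfolding set_eq_iff mem_Collect_eq singleton_iff by metis
  then show "nu TYPE('k) \<B> = 1" by (simp add: nu_def)
next
  assume nu: "nu TYPE('k) \<B> = 1"
  define X where "X = {(Poly_Mapping.keys ` S) | S :: ((nat set \<Rightarrow>\<^sub>0 nat) \<Rightarrow>\<^sub>0 'k) set.
      minimal_binomial_gens \<B> S}"
  \<comment> \<open>The value 1 excludes both the empty family and an infinite one, whose
    \<open>card\<close> is 0, so there is a minimal generating set to modify.\<close>
  obtain K where K: "X = {K}"
    using nu unfolding nu_def X_def by (rule card_1_singletonE)
  then have "K \<in> X" by simp
  then obtain S :: "((nat set \<Rightarrow>\<^sub>0 nat) \<Rightarrow>\<^sub>0 'k) set" where S: "minimal_binomial_gens \<B> S"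
    unfolding X_def by (elim CollectE exE conjE)
  have uniq: "Poly_Mapping.keys ` T = K"
    if "minimal_binomial_gens \<B> T" for T :: "((nat set \<Rightarrow>\<^sub>0 nat) \<Rightarrow>\<^sub>0 'k) set"
  proof -
    have "Poly_Mapping.keys ` T \<in> X" unfolding X_def using that by (intro CollectI exI[of _ T]) simp
    then show ?thesis using K by simp
  qed
  show thin
    unfolding thin_def
  proof (intro allI impI, rule ccontr)
    fix P v w
    assume P: "size P = 2" and v: "fib \<B> (mon P) v" and w: "fib \<B> (mon P) w"
      and distinct: "\<not> (mon P = v \<or> mon P = w \<or> v = w)"
    let ?S = "\<lambda>c. {s \<in> S. \<not> Poly_Mapping.keys s \<subseteq> {x. fib \<B> (mon P) x}} \<union>
      {bnm c x | x. fib \<B> (mon P) x \<and> x \<noteq> c}"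
    have keys: "Poly_Mapping.keys ` ?S c = K" if "fib \<B> (mon P) c" for c
      by (rule uniq[OF star_minimal[OF assms S P that]])
    have u: "fib \<B> (mon P) (mon P)" using v by (simp add: fib_def)
    have "bnm v w \<in> ?S v" using w distinct by blast
    then have "Poly_Mapping.keys (bnm v w :: _ \<Rightarrow>\<^sub>0 'k) \<in> Poly_Mapping.keys ` ?S v" by blast
    then have "{v, w} \<in> Poly_Mapping.keys ` ?S (mon P)"
      using keys[OF v] keys[OF u] distinct by (simp add: keys_bnm)
    then obtain s where s: "{v, w} = Poly_Mapping.keys s" "s \<in> ?S (mon P)" by (rule imageE)
    have "Poly_Mapping.keys s \<subseteq> {x. fib \<B> (mon P) x}" using v w s(1) by auto
    then obtain x where "s = bnm (mon P) x" "x \<noteq> mon P" using s(2) by auto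
    then have "mon P \<in> {v, w}" using s(1) by (simp add: keys_bnm)
    then show False using distinct by auto
  qed
qed

end

theorem theorem4p2:
  fixes n :: nat and \<B> :: "nat set set"
  assumes "matroid_bases n \<B>"
    and "\<forall>B\<in>\<B>. card B \<ge> 2"
  shows "nu TYPE('k::field) \<B> = 1 \<longleftrightarrow> binary_matroid n \<B> \<and> bg_diameter \<B> \<le> 2"
proof -
  interpret basis_system n \<B> by unfold_locales fact
  have ne: "{} \<notin> \<B>" using assms(2) by force
  show ?thesis
    using nu_eq_1_iff[OF ne] thinI[OF ne] thin_imp_U24_free thin_imp_card_Diff_le binaryI
      binary_imp_U24_free bg_diameter_le_iff by metis
qed

end
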